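(* Let $\Bbbk$ be a field, let $H$ be a finite-dimensional $\Bbbk$-linear bialgebra, and let $M$ be a left-right Yetter-Drinfel'd module over $H$. Then the rank $3$ system $(H,M,H^* )$ can be endowed with the following braiding (i.e. these maps make it a braided system in the category of $\Bbbk$-vector spaces): $$\sigma_{H,H}:h_1\otimes h_2\mapsto h_1h_2\otimes 1_H,\qquad \sigma_{M,M}:m_1\otimes m_2\mapsto m_1\otimes m_2,$$ $$\sigma_{H^*,H^*}:l_1\otimes l_2\mapsto\varepsilon\otimes l_1l_2,\qquad \sigma_{H,M}:h\otimes m\mapsto h_{(2)}m\otimes h_{(1)},$$ $$\sigma_{H,H^*}:h\otimes l\mapsto l_{(1)}(h_{(2)})\,l_{(2)}\otimes h_{(1)},\qquad \sigma_{M,H^*}:m\otimes l\mapsto l_{(1)}(m_{(1)})\,l_{(2)}\otimes m_{(0)}.$$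
   Context: Sweedler notation: $\Delta(h)=h_{(1)}\otimes h_{(2)}$ for $h\in H$, and $\delta(m)=m_{(0)}\otimes m_{(1)}\in M\otimes H$ for the coaction on $M$; $1_H$ is the unit and $\varepsilon$ the counit of $H$. A left-right Yetter-Drinfel'd module over $H$ is a vector space $M$ with a left $H$-module structure and a right $H$-comodule structure such that $(h_{(2)}m)_{(0)}\otimes(h_{(2)}m)_{(1)}h_{(1)}=h_{(1)}m_{(0)}\otimes h_{(2)}m_{(1)}$ for all $h\in H,m\in M$. Structures on $H^*$ are dual to those of $H$ with the following ("rainbow") convention: $(l_1l_2)(h)=l_1(h_{(2)})\,l_2(h_{(1)})$, the unit of $H^*$ is $\varepsilon$, the comultiplication $l\mapsto l_{(1)}\otimes l_{(2)}$ is determined by $l(hh')=l_{(1)}(h')\,l_{(2)}(h)$, and the counit is $l\mapsto l(1_H)$. A braided system of rank $r$ in a monoidal category is an ordered family $V_1,\dots,V_r$ with morphisms (not necessarily invertible) $\sigma_{i,j}:V_i\otimes V_j\to V_j\otimes V_i$ for $1\le i\le j\le r$ (together called a braiding) satisfying, for all $1\le i\le j\le k\le r$, the colored Yang-Baxter equation on $V_i\otimes V_j\otimes V_k$: $$(\sigma_{j,k}\otimes\mathrm{Id}_i)(\mathrm{Id}_j\otimes\sigma_{i,k})(\sigma_{i,j}\otimes\mathrm{Id}_k)=(\mathrm{Id}_k\otimes\sigma_{i,j})(\sigma_{i,k}\otimes\mathrm{Id}_j)(\mathrm{Id}_i\otimes\sigma_{j,k}),$$ where $\mathrm{Id}_t=\mathrm{Id}_{V_t}$.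 Here $V_1=H$, $V_2=M$, $V_3=H^*$. *)

theory Defs
  imports Complex_Main "HOL-Library.FuncSet" "HOL-Library.Function_Algebras"
begin

section \<open>Vector spaces as subspaces of an ambient vector space\<close>

text \<open>
  The dual space and tensor products live on types of functions, on which only a subset of the
  elements is wanted. A vector space over \<open>'k\<close> is therefore given by a scalar multiplication that
  makes the whole ambient type a vector space, together with a subspace, the carrier.
\<close>

record ('k, 'v) vspace =
  carr :: "'v set"
  scl :: "'k \<Rightarrow> 'v \<Rightarrow> 'v"

definition is_vspace :: "('k::field, 'v::ab_group_add) vspace \<Rightarrow> bool" where
  "is_vspace V \<longleftrightarrow> vector_space (scl V) \<and> module.subspace (scl V) (carr V)"

definition full :: "('k \<Rightarrow> 'v \<Rightarrow> 'v) \<Rightarrow> ('k, 'v) vspace" where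
  "full s = \<lparr>carr = UNIV, scl = s\<rparr>"

abbreviation scalars :: "('k::field, 'k) vspace" where
  "scalars \<equiv> full (*)"

definition fscale :: "'k::field \<Rightarrow> ('x \<Rightarrow> 'k) \<Rightarrow> ('x \<Rightarrow> 'k)" where
  "fscale c f = (\<lambda>x. c * f x)"

text \<open>Only the values on the carrier matter for a linear or bilinear map.\<close>

definition lin :: "('k::field, 'v::ab_group_add) vspace \<Rightarrow> ('k, 'w::ab_group_add) vspace \<Rightarrow> ('v \<Rightarrow> 'w) \<Rightarrow> bool" where
  "lin V W f \<longleftrightarrow> f \<in> carr V \<rightarrow> carr W \<and>
     (\<forall>x\<in>carr V. \<forall>y\<in>carr V. f (x + y) = f x + f y) \<and>
     (\<forall>c. \<forall>x\<in>carr V. f (scl V c x) = scl W c (f x))"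

definition bilin :: "('k::field, 'v::ab_group_add) vspace \<Rightarrow> ('k, 'w::ab_group_add) vspace \<Rightarrow>
    ('k, 'x::ab_group_add) vspace \<Rightarrow> ('v \<Rightarrow> 'w \<Rightarrow> 'x) \<Rightarrow> bool" where
  "bilin V W X f \<longleftrightarrow> (\<forall>v\<in>carr V. lin W X (f v)) \<and> (\<forall>w\<in>carr W. lin V X (\<lambda>v. f v w))"


section \<open>Tensor products\<close>

text \<open>
  The pure tensor \<open>v \<otimes> w\<close> is realised as evaluation at \<open>(v, w)\<close> of bilinear forms on \<open>V \<times> W\<close>, and
  \<open>V \<otimes> W\<close> as the span of the pure tensors. Over a field this is a tensor product in arbitrary
  dimension: it has the universal property, see \<open>tensor_universal\<close> below.
\<close>

type_synonym ('k, 'v, 'w) tensor = "('v \<Rightarrow> 'w \<Rightarrow> 'k) \<Rightarrow> 'k"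

definition tens :: "('k::field, 'v::ab_group_add) vspace \<Rightarrow> ('k, 'w::ab_group_add) vspace \<Rightarrow>
    'v \<Rightarrow> 'w \<Rightarrow> ('k, 'v, 'w) tensor" where
  "tens V W v w = (\<lambda>b. if bilin V W scalars b then b v w else 0)"

abbreviation tens_syn ("_ \<otimes>\<^bsub>_,_\<^esub> _" [76, 0, 0, 76] 75) where
  "v \<otimes>\<^bsub>V,W\<^esub> w \<equiv> tens V W v w"

definition tprod :: "('k::field, 'v::ab_group_add) vspace \<Rightarrow> ('k, 'w::ab_group_add) vspace \<Rightarrow>
    ('k, ('k, 'v, 'w) tensor) vspace" (infixr "\<Otimes>" 80) where
  "V \<Otimes> W = \<lparr>carr = module.span fscale {v \<otimes>\<^bsub>V,W\<^esub> w | v w. v \<in> carr V \<and> w \<in> carr W}, scl = fscale\<rparr>"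

text \<open>
  Sweedler notation: if \<open>T = v\<^sub>1 \<otimes> w\<^sub>1 + \<dots> + v\<^sub>n \<otimes> w\<^sub>n\<close>, then
  \<open>tsum V W T f = f v\<^sub>1 w\<^sub>1 + \<dots> + f v\<^sub>n w\<^sub>n\<close>. For bilinear \<open>f\<close> this does not depend on the
  decomposition of \<open>T\<close>, and \<open>\<lambda>T. tsum V W T f\<close> is the linear map \<open>v \<otimes> w \<mapsto> f v w\<close>.
\<close>

definition tsum :: "('k::field, 'v::ab_group_add) vspace \<Rightarrow> ('k, 'w::ab_group_add) vspace \<Rightarrow>
    ('k, 'v, 'w) tensor \<Rightarrow> ('v \<Rightarrow> 'w \<Rightarrow> 'x::ab_group_add) \<Rightarrow> 'x" where
  "tsum V W T f = (THE x. \<exists>ts. set ts \<subseteq> carr V \<times> carr W \<and>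
     T = (\<Sum>(v, w)\<leftarrow>ts. v \<otimes>\<^bsub>V,W\<^esub> w) \<and> x = (\<Sum>(v, w)\<leftarrow>ts. f v w))"

lemma lin_full: "vector_space s \<Longrightarrow> vector_space s' \<Longrightarrow>
    lin (full s) (full s') f \<longleftrightarrow> Vector_Spaces.linear s s' f"
  unfolding module_hom_iff_linear[symmetric] module_hom_def module_iff_vector_space
  by (auto simp: lin_def full_def module_hom_axioms_def)

lemma vector_space_fscale: "vector_space (fscale :: 'k::field \<Rightarrow> ('x \<Rightarrow> 'k) \<Rightarrow> ('x \<Rightarrow> 'k))"
  by standard (auto simp: fscale_def fun_eq_iff algebra_simps)

lemma fscale_add: "fscale c (f + g) = fscale c f + fscale c g"
  and fscale_zero: "fscale c 0 = 0"
  by (auto simp: fscale_def fun_eq_iff algebra_simps)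

lemma is_vspace_full: "vector_space s \<Longrightarrow> is_vspace (full s)"
  by (simp add: is_vspace_def full_def module.subspace_UNIV module_iff_vector_space)

lemma is_vspace_tprod: "is_vspace (V \<Otimes> W)"
  using vector_space_fscale
  by (auto simp: is_vspace_def tprod_def module.subspace_span module_iff_vector_space)

lemma is_vspaceD:
  assumes "is_vspace V"
  shows "0 \<in> carr V" "x \<in> carr V \<Longrightarrow> y \<in> carr V \<Longrightarrow> x + y \<in> carr V" "x \<in> carr V \<Longrightarrow> scl V c x \<in> carr V"
    "scl V c (x + y) = scl V c x + scl V c y" "scl V c 0 = 0"
proof -
  interpret vector_space "scl V" using assms by (simp add: is_vspace_def)
  have s: "subspace (carr V)" using assms by (simp add: is_vspace_def)
  show "0 \<in> carr V" "x \<in> carr V \<Longrightarrow> y \<in> carr V \<Longrightarrow> x + y \<in> carr V" "x \<in> carr V \<Longrightarrow> scl V c x \<in> carr V"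
    using s by (auto simp: subspace_def)
  show "scl V c (x + y) = scl V c x + scl V c y" "scl V c 0 = 0"
    by (auto simp: scale_right_distrib)
qed

lemma tens_in_tprod: "v \<in> carr V \<Longrightarrow> w \<in> carr W \<Longrightarrow> v \<otimes>\<^bsub>V,W\<^esub> w \<in> carr (V \<Otimes> W)"
  using module.span_superset[of fscale "{v \<otimes>\<^bsub>V,W\<^esub> w | v w. v \<in> carr V \<and> w \<in> carr W}"]
    vector_space_fscale
  by (auto simp: tprod_def module_iff_vector_space)

lemma bilin_iff: "bilin V W X f \<longleftrightarrow>
    (\<forall>v\<in>carr V. \<forall>w\<in>carr W. f v w \<in> carr X) \<and>
    (\<forall>v\<in>carr V. \<forall>w\<in>carr W. \<forall>w'\<in>carr W. f v (w + w') = f v w + f v w') \<and>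
    (\<forall>c. \<forall>v\<in>carr V. \<forall>w\<in>carr W. f v (scl W c w) = scl X c (f v w)) \<and>
    (\<forall>v\<in>carr V. \<forall>v'\<in>carr V. \<forall>w\<in>carr W. f (v + v') w = f v w + f v' w) \<and>
    (\<forall>c. \<forall>v\<in>carr V. \<forall>w\<in>carr W. f (scl V c v) w = scl X c (f v w))"
  unfolding bilin_def lin_def Pi_iff by blast

lemma bilin_scalars: "bilin V W scalars f \<longleftrightarrow>
    (\<forall>v\<in>carr V. \<forall>w\<in>carr W. \<forall>w'\<in>carr W. f v (w + w') = f v w + f v w') \<and>
    (\<forall>c. \<forall>v\<in>carr V. \<forall>w\<in>carr W. f v (scl W c w) = c * f v w) \<and>
    (\<forall>v\<in>carr V. \<forall>v'\<in>carr V. \<forall>w\<in>carr W. f (v + v') w = f v w + f v' w) \<and>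
    (\<forall>c. \<forall>v\<in>carr V. \<forall>w\<in>carr W. f (scl V c v) w = c * f v w)"
  by (simp add: bilin_iff full_def)

lemma scl_tprod [simp]: "scl (V \<Otimes> W) = fscale"
  by (simp add: tprod_def)

lemma bilin_tens: "bilin V W (V \<Otimes> W) (tens V W)"
  unfolding bilin_iff scl_tprod
  by (intro conjI ballI allI tens_in_tprod)
    (auto simp: tens_def fscale_def fun_eq_iff bilin_scalars)

lemma tprod_decomp:
  assumes V: "is_vspace V" and T: "T \<in> carr (V \<Otimes> W)"
  shows "\<exists>ts. set ts \<subseteq> carr V \<times> carr W \<and> T = (\<Sum>(v, w)\<leftarrow>ts. v \<otimes>\<^bsub>V,W\<^esub> w)"
proof -
  interpret t: vector_space "fscale :: 'a \<Rightarrow> ('a, 'b, 'c) tensor \<Rightarrow> ('a, 'b, 'c) tensor"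
    by (rule vector_space_fscale)
  have "T \<in> t.span {v \<otimes>\<^bsub>V,W\<^esub> w | v w. v \<in> carr V \<and> w \<in> carr W}"
    using T by (simp add: tprod_def)
  then show ?thesis
  proof (induction rule: t.span_induct_alt)
    case base
    show ?case by (rule exI[of _ "[]"]) simp
  next
    case (step c x y)
    then obtain v w ts where *: "x = v \<otimes>\<^bsub>V,W\<^esub> w" "v \<in> carr V" "w \<in> carr W"
      "set ts \<subseteq> carr V \<times> carr W" "y = (\<Sum>(v, w)\<leftarrow>ts. v \<otimes>\<^bsub>V,W\<^esub> w)" by blast
    have "fscale c x = scl V c v \<otimes>\<^bsub>V,W\<^esub> w"
      using bilin_tens[of V W] * by (simp add: bilin_iff)
    then show ?case using * is_vspaceD(3)[OF V]
      by (intro exI[of _ "(scl V c v, w) # ts"]) auto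
  qed
qed

lemma linear_functional_separates:
  assumes "vector_space s" "x \<noteq> 0"
  shows "\<exists>\<phi>. Vector_Spaces.linear s (*) \<phi> \<and> \<phi> x = 1"
proof -
  interpret k: vector_space "(*) :: 'a::field \<Rightarrow> _" by standard (auto simp: algebra_simps)
  interpret s: vector_space s by fact
  interpret vector_space_pair s "(*) :: 'a \<Rightarrow> _" ..
  have "s.independent {x}" using assms(2) by simp
  from linear_independent_extend[OF this, of "\<lambda>_. 1"] show ?thesis by auto
qed

lemma tsum_unique:
  assumes X: "is_vspace X" and f: "bilin V W X f"
    and ts: "set ts \<subseteq> carr V \<times> carr W" and us: "set us \<subseteq> carr V \<times> carr W"
    and eq: "(\<Sum>(v, w)\<leftarrow>ts. v \<otimes>\<^bsub>V,W\<^esub> w) = (\<Sum>(v, w)\<leftarrow>us. v \<otimes>\<^bsub>V,W\<^esub> w)"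
  shows "(\<Sum>(v, w)\<leftarrow>ts. f v w) = (\<Sum>(v, w)\<leftarrow>us. f v w)"
proof (rule ccontr)
  assume "\<not> ?thesis"
  then have "(\<Sum>(v, w)\<leftarrow>ts. f v w) - (\<Sum>(v, w)\<leftarrow>us. f v w) \<noteq> 0" by simp
  then obtain \<phi> where \<phi>: "Vector_Spaces.linear (scl X) (*) \<phi>"
    "\<phi> ((\<Sum>(v, w)\<leftarrow>ts. f v w) - (\<Sum>(v, w)\<leftarrow>us. f v w)) = 1"
    using linear_functional_separates X unfolding is_vspace_def by blast
  interpret \<phi>: Vector_Spaces.linear "scl X" "(*)" \<phi> by (rule \<phi>(1))
  have b: "bilin V W scalars (\<lambda>v w. \<phi> (f v w))"
    using f by (simp add: bilin_iff full_def \<phi>.add \<phi>.scale)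
  have *: "\<phi> (\<Sum>(v, w)\<leftarrow>ts. f v w) = (\<Sum>(v, w)\<leftarrow>ts. v \<otimes>\<^bsub>V,W\<^esub> w) (\<lambda>v w. \<phi> (f v w))" for ts
    using b by (induction ts) (auto simp: \<phi>.add \<phi>.zero tens_def)
  have "\<phi> ((\<Sum>(v, w)\<leftarrow>ts. f v w) - (\<Sum>(v, w)\<leftarrow>us. f v w)) = 0"
    by (simp add: \<phi>.diff * eq)
  with \<phi>(2) show False by simp
qed

lemma tsum_eq:
  assumes "is_vspace X" "bilin V W X f" "set ts \<subseteq> carr V \<times> carr W"
  shows "tsum V W (\<Sum>(v, w)\<leftarrow>ts. v \<otimes>\<^bsub>V,W\<^esub> w) f = (\<Sum>(v, w)\<leftarrow>ts. f v w)"
  unfolding tsum_def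
proof (rule the_equality)
  show "\<exists>us. set us \<subseteq> carr V \<times> carr W \<and>
      (\<Sum>(v, w)\<leftarrow>ts. v \<otimes>\<^bsub>V,W\<^esub> w) = (\<Sum>(v, w)\<leftarrow>us. v \<otimes>\<^bsub>V,W\<^esub> w) \<and>
      (\<Sum>(v, w)\<leftarrow>ts. f v w) = (\<Sum>(v, w)\<leftarrow>us. f v w)"
    using assms(3) by blast
qed (use tsum_unique[OF assms(1,2)] assms(3) in metis)

lemma tsum_tens:
  assumes "is_vspace X" "bilin V W X f" "v \<in> carr V" "w \<in> carr W"
  shows "tsum V W (v \<otimes>\<^bsub>V,W\<^esub> w) f = f v w"
  using tsum_eq[OF assms(1,2), of "[(v, w)]"] assms(3,4) by simp

lemma lin_tsum:
  assumes V: "is_vspace V" and X: "is_vspace X" and f: "bilin V W X f"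
  shows "lin (V \<Otimes> W) X (\<lambda>T. tsum V W T f)"
proof -
  note e = tsum_eq[OF X f]
  have mem: "(\<Sum>(v, w)\<leftarrow>ts. f v w) \<in> carr X" if "set ts \<subseteq> carr V \<times> carr W" for ts
    using that f by (induction ts) (auto simp: is_vspaceD[OF X] bilin_iff)
  have 1: "tsum V W T f \<in> carr X" if "T \<in> carr (V \<Otimes> W)" for T
    using tprod_decomp[OF V that] mem e by auto
  have 2: "tsum V W (S + T) f = tsum V W S f + tsum V W T f"
    if S: "S \<in> carr (V \<Otimes> W)" and T: "T \<in> carr (V \<Otimes> W)" for S T
  proof -
    obtain ss ts where *: "set ss \<subseteq> carr V \<times> carr W" "S = (\<Sum>(v, w)\<leftarrow>ss. v \<otimes>\<^bsub>V,W\<^esub> w)"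
      "set ts \<subseteq> carr V \<times> carr W" "T = (\<Sum>(v, w)\<leftarrow>ts. v \<otimes>\<^bsub>V,W\<^esub> w)"
      using tprod_decomp[OF V S] tprod_decomp[OF V T] by blast
    then show ?thesis using e[of "ss @ ts"] e[of ss] e[of ts] by simp
  qed
  have 3: "tsum V W (fscale c T) f = scl X c (tsum V W T f)" if T: "T \<in> carr (V \<Otimes> W)" for c T
  proof -
    obtain ts where *: "set ts \<subseteq> carr V \<times> carr W" "T = (\<Sum>(v, w)\<leftarrow>ts. v \<otimes>\<^bsub>V,W\<^esub> w)"
      using tprod_decomp[OF V T] by blast
    let ?us = "map (\<lambda>(v, w). (scl V c v, w)) ts"
    have us: "set ?us \<subseteq> carr V \<times> carr W" using *(1) is_vspaceD(3)[OF V] by auto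
    have "fscale c (v \<otimes>\<^bsub>V,W\<^esub> w) = scl V c v \<otimes>\<^bsub>V,W\<^esub> w" if "v \<in> carr V" "w \<in> carr W" for v w
      using bilin_tens[of V W] that by (simp add: bilin_iff)
    then have a: "fscale c T = (\<Sum>(v, w)\<leftarrow>?us. v \<otimes>\<^bsub>V,W\<^esub> w)"
      unfolding *(2) using *(1) by (induction ts) (auto simp: fscale_add fscale_zero)
    have b: "(\<Sum>(v, w)\<leftarrow>?us. f v w) = scl X c (\<Sum>(v, w)\<leftarrow>ts. f v w)"
      using *(1) f by (induction ts) (auto simp: is_vspaceD[OF X] bilin_iff)
    show ?thesis unfolding a unfolding e[OF us] b unfolding *(2) e[OF *(1)] ..
  qed
  show ?thesis using 1 2 3 by (auto simp: lin_def)
qed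

lemma lin_eq_on_tprod:
  assumes V: "is_vspace V"
    and g: "lin (V \<Otimes> W) X g" and h: "lin (V \<Otimes> W) X h"
    and eq: "\<And>v w. v \<in> carr V \<Longrightarrow> w \<in> carr W \<Longrightarrow> g (v \<otimes>\<^bsub>V,W\<^esub> w) = h (v \<otimes>\<^bsub>V,W\<^esub> w)"
    and T: "T \<in> carr (V \<Otimes> W)"
  shows "g T = h T"
proof -
  note P = is_vspaceD[OF is_vspace_tprod[of V W]]
  obtain ts where *: "set ts \<subseteq> carr V \<times> carr W" "T = (\<Sum>(v, w)\<leftarrow>ts. v \<otimes>\<^bsub>V,W\<^esub> w)"
    using tprod_decomp[OF V T] by blast
  have zero: "k 0 = 0" if "lin (V \<Otimes> W) X k" for k
  proof -
    have "k (0 + 0) = k 0 + k 0" using that P(1) unfolding lin_def by blast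
    then show ?thesis by simp
  qed
  have "(\<Sum>(v, w)\<leftarrow>ts. v \<otimes>\<^bsub>V,W\<^esub> w) \<in> carr (V \<Otimes> W) \<and>
      g (\<Sum>(v, w)\<leftarrow>ts. v \<otimes>\<^bsub>V,W\<^esub> w) = h (\<Sum>(v, w)\<leftarrow>ts. v \<otimes>\<^bsub>V,W\<^esub> w)"
    using *(1)
  proof (induction ts)
    case Nil
    show ?case using zero[OF g] zero[OF h] P(1) by (simp add: zero_fun_def)
  next
    case (Cons t ts)
    then obtain v w where t: "t = (v, w)" "v \<in> carr V" "w \<in> carr W" by auto
    then show ?case using Cons g h eq[of v w] P(2) tens_in_tprod[of v V w W]
      by (auto simp: lin_def simp del: plus_fun_apply)
  qed
  with * show ?thesis by simp
qed

theorem tensor_universal: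
  assumes "is_vspace V" "is_vspace W" "is_vspace X" "bilin V W X f"
  shows "\<exists>g. lin (V \<Otimes> W) X g \<and> (\<forall>v\<in>carr V. \<forall>w\<in>carr W. g (v \<otimes>\<^bsub>V,W\<^esub> w) = f v w) \<and>
    (\<forall>h. lin (V \<Otimes> W) X h \<and> (\<forall>v\<in>carr V. \<forall>w\<in>carr W. h (v \<otimes>\<^bsub>V,W\<^esub> w) = f v w) \<longrightarrow>
      (\<forall>T\<in>carr (V \<Otimes> W). h T = g T))"
proof -
  let ?g = "\<lambda>T. tsum V W T f"
  have 1: "lin (V \<Otimes> W) X ?g" by (rule lin_tsum[OF assms(1,3,4)])
  have 2: "?g (v \<otimes>\<^bsub>V,W\<^esub> w) = f v w" if "v \<in> carr V" "w \<in> carr W" for v w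
    using tsum_tens[OF assms(3,4) that] .
  have 3: "h T = ?g T" if "lin (V \<Otimes> W) X h" "\<forall>v\<in>carr V. \<forall>w\<in>carr W. h (v \<otimes>\<^bsub>V,W\<^esub> w) = f v w"
    "T \<in> carr (V \<Otimes> W)" for h T
    using lin_eq_on_tprod[OF assms(1) that(1) 1 _ that(3)] that(2) 2 by simp
  show ?thesis
  proof (rule exI[of _ ?g], intro conjI)
    show "lin (V \<Otimes> W) X ?g" by (rule 1)
    show "\<forall>v\<in>carr V. \<forall>w\<in>carr W. ?g (v \<otimes>\<^bsub>V,W\<^esub> w) = f v w" using 2 by blast
    show "\<forall>h. lin (V \<Otimes> W) X h \<and> (\<forall>v\<in>carr V. \<forall>w\<in>carr W. h (v \<otimes>\<^bsub>V,W\<^esub> w) = f v w) \<longrightarrow>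
        (\<forall>T\<in>carr (V \<Otimes> W). h T = ?g T)"
      using 3 by blast
  qed
qed


section \<open>The monoidal structure\<close>

definition tmap :: "('k::field, 'v::ab_group_add) vspace \<Rightarrow> ('k, 'w::ab_group_add) vspace \<Rightarrow>
    ('k, 'v'::ab_group_add) vspace \<Rightarrow> ('k, 'w'::ab_group_add) vspace \<Rightarrow>
    ('v \<Rightarrow> 'v') \<Rightarrow> ('w \<Rightarrow> 'w') \<Rightarrow> ('k, 'v, 'w) tensor \<Rightarrow> ('k, 'v', 'w') tensor" where
  "tmap V W V' W' f g T = tsum V W T (\<lambda>v w. f v \<otimes>\<^bsub>V',W'\<^esub> g w)"

definition assoc_r :: "('k::field, 'u::ab_group_add) vspace \<Rightarrow> ('k, 'v::ab_group_add) vspace \<Rightarrow>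
    ('k, 'w::ab_group_add) vspace \<Rightarrow> ('k, ('k, 'u, 'v) tensor, 'w) tensor \<Rightarrow> ('k, 'u, ('k, 'v, 'w) tensor) tensor" where
  "assoc_r U V W T = tsum (U \<Otimes> V) W T (\<lambda>s w. tsum U V s (\<lambda>u v. u \<otimes>\<^bsub>U,V \<Otimes> W\<^esub> (v \<otimes>\<^bsub>V,W\<^esub> w)))"

definition assoc_l :: "('k::field, 'u::ab_group_add) vspace \<Rightarrow> ('k, 'v::ab_group_add) vspace \<Rightarrow>
    ('k, 'w::ab_group_add) vspace \<Rightarrow> ('k, 'u, ('k, 'v, 'w) tensor) tensor \<Rightarrow> ('k, ('k, 'u, 'v) tensor, 'w) tensor" where
  "assoc_l U V W T = tsum U (V \<Otimes> W) T (\<lambda>u s. tsum V W s (\<lambda>v w. (u \<otimes>\<^bsub>U,V\<^esub> v) \<otimes>\<^bsub>U \<Otimes> V,W\<^esub> w))"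


section \<open>Braided systems\<close>

text \<open>
  Threefold tensor products are bracketed as \<open>(U \<otimes> V) \<otimes> W\<close>. For \<open>f\<close> from \<open>U \<otimes> V\<close> to \<open>V \<otimes> U\<close>,
  \<open>on_left U V W f\<close> is \<open>f \<otimes> Id\<^sub>W\<close>; for \<open>f\<close> from \<open>V \<otimes> W\<close> to \<open>W \<otimes> V\<close>, \<open>on_right U V W f\<close> is
  \<open>Id\<^sub>U \<otimes> f\<close> conjugated by the associators.
\<close>

definition on_left where
  "on_left U V W f = tmap (U \<Otimes> V) W (V \<Otimes> U) W f id"

definition on_right where
  "on_right U V W f = assoc_l U W V \<circ> tmap U (V \<Otimes> W) U (W \<Otimes> V) id f \<circ> assoc_r U V W"

definition colored_yang_baxter where
  "colored_yang_baxter U V W \<sigma>UV \<sigma>UW \<sigma>VW \<longleftrightarrow> (\<forall>T\<in>carr ((U \<Otimes> V) \<Otimes> W).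
     (on_left V W U \<sigma>VW \<circ> on_right V U W \<sigma>UW \<circ> on_left U V W \<sigma>UV) T =
     (on_right W U V \<sigma>UV \<circ> on_left U W V \<sigma>UW \<circ> on_right U V W \<sigma>VW) T)"

text \<open>
  A braided system of rank 3. The component spaces have different types, so the family and the
  instances for \<open>i \<le> j \<le> k\<close> of the Yang-Baxter equation are written out.
\<close>

definition braided_system3 where
  "braided_system3 V1 V2 V3 \<sigma>11 \<sigma>12 \<sigma>13 \<sigma>22 \<sigma>23 \<sigma>33 \<longleftrightarrow>
     is_vspace V1 \<and> is_vspace V2 \<and> is_vspace V3 \<and>
     lin (V1 \<Otimes> V1) (V1 \<Otimes> V1) \<sigma>11 \<and> lin (V1 \<Otimes> V2) (V2 \<Otimes> V1) \<sigma>12 \<and>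
     lin (V1 \<Otimes> V3) (V3 \<Otimes> V1) \<sigma>13 \<and> lin (V2 \<Otimes> V2) (V2 \<Otimes> V2) \<sigma>22 \<and>
     lin (V2 \<Otimes> V3) (V3 \<Otimes> V2) \<sigma>23 \<and> lin (V3 \<Otimes> V3) (V3 \<Otimes> V3) \<sigma>33 \<and>
     colored_yang_baxter V1 V1 V1 \<sigma>11 \<sigma>11 \<sigma>11 \<and>
     colored_yang_baxter V1 V1 V2 \<sigma>11 \<sigma>12 \<sigma>12 \<and>
     colored_yang_baxter V1 V1 V3 \<sigma>11 \<sigma>13 \<sigma>13 \<and>
     colored_yang_baxter V1 V2 V2 \<sigma>12 \<sigma>12 \<sigma>22 \<and>
     colored_yang_baxter V1 V2 V3 \<sigma>12 \<sigma>13 \<sigma>23 \<and>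
     colored_yang_baxter V1 V3 V3 \<sigma>13 \<sigma>13 \<sigma>33 \<and>
     colored_yang_baxter V2 V2 V2 \<sigma>22 \<sigma>22 \<sigma>22 \<and>
     colored_yang_baxter V2 V2 V3 \<sigma>22 \<sigma>23 \<sigma>23 \<and>
     colored_yang_baxter V2 V3 V3 \<sigma>23 \<sigma>23 \<sigma>33 \<and>
     colored_yang_baxter V3 V3 V3 \<sigma>33 \<sigma>33 \<sigma>33"


section \<open>Bialgebras and Yetter-Drinfel'd modules\<close>

text \<open>
  The class \<open>ring_1\<close> demands \<open>1 \<noteq> 0\<close>, which holds in every bialgebra over a field because
  \<open>\<epsilon> 1 = 1\<close>.
\<close>

locale bialgebra = vector_space sH
  for sH :: "'k::field \<Rightarrow> 'h::ring_1 \<Rightarrow> 'h" +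
  fixes \<Delta> :: "'h \<Rightarrow> ('k, 'h, 'h) tensor" and \<epsilon> :: "'h \<Rightarrow> 'k"
  assumes scale_mult_left: "sH c (a * b) = sH c a * b"
    and scale_mult_right: "sH c (a * b) = a * sH c b"
    and comult_linear: "lin (full sH) (full sH \<Otimes> full sH) \<Delta>"
    and counit_linear: "lin (full sH) scalars \<epsilon>"
    and coassoc:
      "assoc_r (full sH) (full sH) (full sH)
         (tmap (full sH) (full sH) (full sH \<Otimes> full sH) (full sH) \<Delta> id (\<Delta> h)) =
       tmap (full sH) (full sH) (full sH) (full sH \<Otimes> full sH) id \<Delta> (\<Delta> h)"
    and counit_left: "tsum (full sH) (full sH) (\<Delta> h) (\<lambda>h1 h2. sH (\<epsilon> h1) h2) = h"
    and counit_right: "tsum (full sH) (full sH) (\<Delta> h) (\<lambda>h1 h2. sH (\<epsilon> h2) h1) = h"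
    and comult_one: "\<Delta> 1 = 1 \<otimes>\<^bsub>full sH,full sH\<^esub> 1"
    and comult_mult:
      "\<Delta> (a * b) = tsum (full sH) (full sH) (\<Delta> a) (\<lambda>a1 a2.
         tsum (full sH) (full sH) (\<Delta> b) (\<lambda>b1 b2. (a1 * b1) \<otimes>\<^bsub>full sH,full sH\<^esub> (a2 * b2)))"
    and counit_one: "\<epsilon> 1 = 1"
    and counit_mult: "\<epsilon> (a * b) = \<epsilon> a * \<epsilon> b"

locale yetter_drinfeld_module = bialgebra sH \<Delta> \<epsilon> + M: vector_space sM
  for sH :: "'k::field \<Rightarrow> 'h::ring_1 \<Rightarrow> 'h" and \<Delta> and \<epsilon> and sM :: "'k \<Rightarrow> 'm::ab_group_add \<Rightarrow> 'm" +
  fixes act :: "'h \<Rightarrow> 'm \<Rightarrow> 'm" and \<delta> :: "'m \<Rightarrow> ('k, 'm, 'h) tensor"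
  assumes act_bilinear: "bilin (full sH) (full sM) (full sM) act"
    and act_one: "act 1 m = m"
    and act_mult: "act (a * b) m = act a (act b m)"
    and coact_linear: "lin (full sM) (full sM \<Otimes> full sH) \<delta>"
    and coact_coassoc:
      "assoc_r (full sM) (full sH) (full sH)
         (tmap (full sM) (full sH) (full sM \<Otimes> full sH) (full sH) \<delta> id (\<delta> m)) =
       tmap (full sM) (full sH) (full sM) (full sH \<Otimes> full sH) id \<Delta> (\<delta> m)"
    and coact_counit: "tsum (full sM) (full sH) (\<delta> m) (\<lambda>m0 m1. sM (\<epsilon> m1) m0) = m"
    and yetter_drinfeld:
      "tsum (full sH) (full sH) (\<Delta> h) (\<lambda>h1 h2.
         tsum (full sM) (full sH) (\<delta> (act h2 m)) (\<lambda>n0 n1. n0 \<otimes>\<^bsub>full sM,full sH\<^esub> (n1 * h1))) =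
       tsum (full sH) (full sH) (\<Delta> h) (\<lambda>h1 h2.
         tsum (full sM) (full sH) (\<delta> m) (\<lambda>m0 m1. act h1 m0 \<otimes>\<^bsub>full sM,full sH\<^esub> (h2 * m1)))"


section \<open>The dual of a finite-dimensional bialgebra\<close>

text \<open>
  The convention is opposite to the usual convolution: \<open>(l l')(h) = l(h\<^sub>2) l'(h\<^sub>1)\<close> and
  \<open>l(h h') = l\<^sub>1(h') l\<^sub>2(h)\<close>. The unit is \<open>\<epsilon>\<close>.
\<close>

definition dual :: "('k::field \<Rightarrow> 'h::ab_group_add \<Rightarrow> 'h) \<Rightarrow> ('k, 'h \<Rightarrow> 'k) vspace" where
  "dual s = \<lparr>carr = {l. Vector_Spaces.linear s (*) l}, scl = fscale\<rparr>"

definition dual_mult :: "('k::field \<Rightarrow> 'h::ab_group_add \<Rightarrow> 'h) \<Rightarrow> ('h \<Rightarrow> ('k, 'h, 'h) tensor) \<Rightarrow>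
    ('h \<Rightarrow> 'k) \<Rightarrow> ('h \<Rightarrow> 'k) \<Rightarrow> ('h \<Rightarrow> 'k)" where
  "dual_mult sH \<Delta> l l' = (\<lambda>h. tsum (full sH) (full sH) (\<Delta> h) (\<lambda>h1 h2. l h2 * l' h1))"

definition dual_comult :: "('k::field \<Rightarrow> 'h::ring_1 \<Rightarrow> 'h) \<Rightarrow> ('h \<Rightarrow> 'k) \<Rightarrow> ('k, 'h \<Rightarrow> 'k, 'h \<Rightarrow> 'k) tensor" where
  "dual_comult sH l = (THE t. t \<in> carr (dual sH \<Otimes> dual sH) \<and>
     (\<forall>h h'. l (h * h') = tsum (dual sH) (dual sH) t (\<lambda>l1 l2. l1 h' * l2 h)))"

lemma mem_dual: "vector_space s \<Longrightarrow>
    l \<in> carr (dual s) \<longleftrightarrow> (\<forall>x y. l (x + y) = l x + l y) \<and> (\<forall>c x. l (s c x) = c * l x)"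
proof -
  have "vector_space ((*) :: 'a::field \<Rightarrow> 'a \<Rightarrow> 'a)" by standard (auto simp: algebra_simps)
  then show "vector_space s \<Longrightarrow> ?thesis" by (simp add: dual_def Vector_Spaces.linear_iff)
qed

lemma is_vspace_dual:
  assumes "vector_space s"
  shows "is_vspace (dual s)"
proof -
  have f: "vector_space (scl (dual s))" by (simp add: dual_def vector_space_fscale)
  then interpret f: vector_space "scl (dual s)" .
  have "f.subspace (carr (dual s))"
    unfolding f.subspace_def mem_dual[OF assms] Ball_def
    by (simp add: dual_def fscale_def distrib_left mult.left_commute add_ac)
  with f show ?thesis by (simp add: is_vspace_def)
qed

text \<open>The condition defining \<open>dual_comult\<close> has exactly one solution.\<close>

lemma dual_comult_ex1:
  fixes sH :: "'k::field \<Rightarrow> 'h::ring_1 \<Rightarrow> 'h"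
  assumes fd: "finite_dimensional_vector_space sH B"
    and alg: "\<And>c a b. sH c (a * b) = sH c a * b" "\<And>c a b. sH c (a * b) = a * sH c b"
    and l: "l \<in> carr (dual sH)"
  shows "\<exists>!t. t \<in> carr (dual sH \<Otimes> dual sH) \<and>
    (\<forall>h h'. l (h * h') = tsum (dual sH) (dual sH) t (\<lambda>l1 l2. l1 h' * l2 h))"
proof -
  interpret finite_dimensional_vector_space sH B by fact
  interpret k: vector_space "(*) :: 'k \<Rightarrow> _" by standard (auto simp: algebra_simps)
  interpret vector_space_pair sH "(*) :: 'k \<Rightarrow> _" ..
  let ?D = "dual sH"
  have D: "is_vspace ?D" by (rule is_vspace_dual) unfold_locales
  have S: "is_vspace (scalars :: ('k, 'k) vspace)" by (rule is_vspace_full) unfold_locales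
  have Dlin: "f (x + y) = f x + f y" "f (sH c x) = c * f x" "f 0 = 0" if "f \<in> carr ?D" for f x y c
    using that linear_0[of f] by (auto simp: dual_def Vector_Spaces.linear_iff)
  have DI: "f \<in> carr ?D" if "\<And>x y. f (x + y) = f x + f y" "\<And>c x. f (sH c x) = c * f x" for f
    using that by (auto simp: dual_def Vector_Spaces.linear_iff vector_space_axioms k.vector_space_axioms)
  obtain bs where bs: "set bs = B" "distinct bs"
    using finite_distinct_list[OF finite_Basis] by blast
  define r where "r = (\<lambda>b h. representation B h b)"
  have r: "r b \<in> carr ?D" for b
    by (rule DI) (simp_all add: r_def representation_add representation_scale independent_Basis span_Basis)
  have expand: "(\<Sum>b\<leftarrow>bs. sH (r b h) b) = h" for h
    using sum_representation_eq[OF independent_Basis, of h B] finite_Basis span_Basis bs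
    by (simp add: r_def sum_list_distinct_conv_sum_set)
  have Dexpand: "(\<Sum>b\<leftarrow>bs. r b h * f b) = f h" if "f \<in> carr ?D" for f h
  proof -
    have "f (\<Sum>b\<leftarrow>cs. sH (r b h) b) = (\<Sum>b\<leftarrow>cs. r b h * f b)" for cs
      by (induction cs) (auto simp: Dlin[OF that])
    from this[of bs] show ?thesis by (simp add: expand)
  qed
  have ev: "bilin ?D ?D scalars (\<lambda>l1 l2. l1 h' * l2 h)" for h h'
    unfolding bilin_scalars by (simp add: dual_def fscale_def distrib_left distrib_right)
  note te = tsum_eq[OF S ev]
  define L where "L = (\<lambda>b h'. l (b * h'))"
  have L: "L b \<in> carr ?D" "(\<lambda>b. L b h') \<in> carr ?D" for b h'
    by (rule DI; simp add: L_def distrib_left distrib_right Dlin[OF l] flip: alg)+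
  let ?t = "\<Sum>(v, w)\<leftarrow>map (\<lambda>b. (L b, r b)) bs. v \<otimes>\<^bsub>?D,?D\<^esub> w"
  have t_set: "set (map (\<lambda>b. (L b, r b)) bs) \<subseteq> carr ?D \<times> carr ?D" using L r by auto
  have 1: "?t \<in> carr (?D \<Otimes> ?D)"
  proof -
    have "(\<Sum>(v, w)\<leftarrow>map (\<lambda>b. (L b, r b)) cs. v \<otimes>\<^bsub>?D,?D\<^esub> w) \<in> carr (?D \<Otimes> ?D)" for cs
      by (induction cs) (simp_all add: is_vspaceD(1,2)[OF is_vspace_tprod] tens_in_tprod L r zero_fun_def[symmetric]
        del: plus_fun_apply zero_fun_apply)
    then show ?thesis .
  qed
  have 2: "l (h * h') = tsum ?D ?D ?t (\<lambda>l1 l2. l1 h' * l2 h)" for h h'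
    unfolding te[OF t_set] using Dexpand[OF L(2), of h h'] by (simp add: L_def o_def mult.commute)
  have key: "T \<beta> = (\<Sum>b\<leftarrow>bs. \<beta> (\<lambda>h'. tsum ?D ?D T (\<lambda>l1 l2. l1 h' * l2 b)) (r b))"
    if T: "T \<in> carr (?D \<Otimes> ?D)" and \<beta>: "bilin ?D ?D scalars \<beta>" for T \<beta>
  proof -
    obtain ts where ts: "set ts \<subseteq> carr ?D \<times> carr ?D" "T = (\<Sum>(v, w)\<leftarrow>ts. v \<otimes>\<^bsub>?D,?D\<^esub> w)"
      using tprod_decomp[OF D T] by blast
    note \<beta>' = \<beta>[unfolded bilin_scalars]
    have "T \<beta> = (\<Sum>(v, w)\<leftarrow>ts. \<beta> v w)"
      unfolding ts(2) using \<beta> by (induction ts) (auto simp: tens_def)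
    also have "\<dots> = (\<Sum>b\<leftarrow>bs. \<beta> (\<lambda>h'. \<Sum>(v, w)\<leftarrow>ts. v h' * w b) (r b))"
      using ts(1)
    proof (induction ts)
      case Nil
      have "\<beta> (fscale 0 0) (r b) = 0 * \<beta> 0 (r b)" for b
        using \<beta>' is_vspaceD(1)[OF D] r by (auto simp: dual_def)
      then show ?case by (simp add: fscale_def zero_fun_def)
    next
      case (Cons t ts)
      obtain v w where t: "t = (v, w)" "v \<in> carr ?D" "w \<in> carr ?D" using Cons by auto
      have add: "(\<Sum>(v, w)\<leftarrow>us. v (x + y) * w b) = (\<Sum>(v, w)\<leftarrow>us. v x * w b) + (\<Sum>(v, w)\<leftarrow>us. v y * w b)"
        if "set us \<subseteq> carr ?D \<times> carr ?D" for us x y b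
        using that by (induction us) (auto simp: Dlin distrib_right)
      have scale: "(\<Sum>(v, w)\<leftarrow>us. v (sH c x) * w b) = c * (\<Sum>(v, w)\<leftarrow>us. v x * w b)"
        if "set us \<subseteq> carr ?D \<times> carr ?D" for us c x b
        using that by (induction us) (auto simp: Dlin distrib_left)
      have rest: "(\<lambda>h'. \<Sum>(v, w)\<leftarrow>ts. v h' * w b) \<in> carr ?D" for b
        using Cons.prems by (intro DI add scale) auto
      have v: "fscale c v \<in> carr ?D" for c using is_vspaceD(3)[OF D t(2), of c] by (simp add: dual_def)
      have "\<beta> v w = (\<Sum>b\<leftarrow>bs. w b * \<beta> v (r b))"
      proof -
        have lin: "\<beta> v (fscale c f) = c * \<beta> v f" "fscale c f \<in> carr ?D" if "f \<in> carr ?D" for c f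
          using \<beta>' t(2) that is_vspaceD(3)[OF D that, of c] by (auto simp: dual_def)
        have z: "\<beta> v 0 = 0" using lin[of 0 0] is_vspaceD(1)[OF D] by (simp add: fscale_def zero_fun_def)
        have "(\<Sum>b\<leftarrow>cs. fscale (w b) (r b)) \<in> carr ?D \<and>
            \<beta> v (\<Sum>b\<leftarrow>cs. fscale (w b) (r b)) = (\<Sum>b\<leftarrow>cs. w b * \<beta> v (r b))" for cs
          using \<beta>' t(2) is_vspaceD(1,2)[OF D] by (induction cs) (auto simp: z lin r)
        moreover have "(\<Sum>b\<leftarrow>bs. fscale (w b) (r b)) = w"
        proof
          fix h
          have "(\<Sum>b\<leftarrow>cs. fscale (w b) (r b)) h = (\<Sum>b\<leftarrow>cs. r b h * w b)" for cs
            by (induction cs) (auto simp: fscale_def mult.commute)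
          then show "(\<Sum>b\<leftarrow>bs. fscale (w b) (r b)) h = w h" by (simp add: Dexpand t(3))
        qed
        ultimately show ?thesis by metis
      qed
      moreover have "\<beta> (\<lambda>h'. \<Sum>(v, w)\<leftarrow>t # ts. v h' * w b) (r b) =
          w b * \<beta> v (r b) + \<beta> (\<lambda>h'. \<Sum>(v, w)\<leftarrow>ts. v h' * w b) (r b)" for b
      proof -
        have "(\<lambda>h'. \<Sum>(v, w)\<leftarrow>t # ts. v h' * w b) = fscale (w b) v + (\<lambda>h'. \<Sum>(v, w)\<leftarrow>ts. v h' * w b)"
          by (auto simp: t fscale_def fun_eq_iff mult.commute)
        moreover have "\<beta> (fscale (w b) v) (r b) = w b * \<beta> v (r b)"
          using \<beta>' t(2) r by (auto simp: dual_def)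
        ultimately show ?thesis using \<beta>' rest v r by simp
      qed
      ultimately show ?case using Cons by (simp add: t(1) sum_list_addf)
    qed
    also have "\<dots> = (\<Sum>b\<leftarrow>bs. \<beta> (\<lambda>h'. tsum ?D ?D T (\<lambda>l1 l2. l1 h' * l2 b)) (r b))"
      unfolding ts(2) te[OF ts(1)] ..
    finally show ?thesis .
  qed
  have outside: "T \<beta> = 0" if T: "T \<in> carr (?D \<Otimes> ?D)" and \<beta>: "\<not> bilin ?D ?D scalars \<beta>" for T \<beta>
  proof -
    obtain ts where "T = (\<Sum>(v, w)\<leftarrow>ts. v \<otimes>\<^bsub>?D,?D\<^esub> w)"
      using tprod_decomp[OF D T] by blast
    then show ?thesis using \<beta> by (induction ts arbitrary: T) (auto simp: tens_def)
  qed
  show ?thesis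
  proof (rule ex1I[of _ ?t])
    show "?t \<in> carr (?D \<Otimes> ?D) \<and> (\<forall>h h'. l (h * h') = tsum ?D ?D ?t (\<lambda>l1 l2. l1 h' * l2 h))"
      using 1 2 by blast
    fix t assume t: "t \<in> carr (?D \<Otimes> ?D) \<and> (\<forall>h h'. l (h * h') = tsum ?D ?D t (\<lambda>l1 l2. l1 h' * l2 h))"
    show "t = ?t"
    proof
      fix \<beta>
      show "t \<beta> = ?t \<beta>"
      proof (cases "bilin ?D ?D scalars \<beta>")
        case True
        have e: "tsum ?D ?D t (\<lambda>l1 l2. l1 h' * l2 b) = tsum ?D ?D ?t (\<lambda>l1 l2. l1 h' * l2 b)" for b h'
          using t 2[of b h'] by metis
        show ?thesis unfolding key[OF conjunct1[OF t] True] key[OF 1 True] e ..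
      next
        case False
        show ?thesis unfolding outside[OF conjunct1[OF t] False] outside[OF 1 False] ..
      qed
    qed
  qed
qed

end

theory Submission
  imports Defs
begin

text \<open>
  Apart from the identity \<open>\<sigma>\<^sub>M\<^sub>,\<^sub>M\<close>, the maps come from two constructions. For a unital associative algebra \<open>A\<close>, both
  \<open>a \<otimes> b \<mapsto> ab \<otimes> 1\<close> and \<open>a \<otimes> b \<mapsto> 1 \<otimes> ab\<close> satisfy the Yang-Baxter equation, by
  associativity; these are \<open>\<sigma>\<^sub>H\<^sub>,\<^sub>H\<close> and \<open>\<sigma>\<^sub>D\<^sub>,\<^sub>D\<close> with \<open>D = H\<^sup>*\<close>. For a right \<open>H\<close>-comodule
  \<open>C\<close> and a left \<open>H\<close>-module \<open>X\<close> there is the map \<open>c \<otimes> x \<mapsto> c\<^sub>1 x \<otimes> c\<^sub>0\<close>, called \<open>braid\<close>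
  below. The dual \<open>D\<close> is a left \<open>H\<close>-module by \<open>(h l)(x) = l(x h)\<close>, and \<open>l\<^sub>1(h) l\<^sub>2 = h l\<close> in the
  convention \<open>l(h h') = l\<^sub>1(h') l\<^sub>2(h)\<close>. Hence \<open>\<sigma>\<^sub>H\<^sub>,\<^sub>M\<close>, \<open>\<sigma>\<^sub>H\<^sub>,\<^sub>D\<close> and \<open>\<sigma>\<^sub>M\<^sub>,\<^sub>D\<close> are all of this
  form, \<open>H\<close> being a comodule over itself by \<open>\<Delta>\<close>.

  The remaining instances of the Yang-Baxter equation are of four kinds.
  \<^item> On \<open>(H, H, X)\<close> for a module \<open>X\<close>, both sides are \<open>a\<^sub>2 b\<^sub>2 x \<otimes> a\<^sub>1 b\<^sub>1 \<otimes> 1\<close> because \<open>\<Delta>\<close> is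
    multiplicative and \<open>X\<close> is a module (\<open>yang_baxter_fuse_braid\<close>, used for \<open>M\<close> and \<open>D\<close>).
  \<^item> On \<open>(C, A, A)\<close> for a comodule \<open>C\<close> and an algebra \<open>A\<close> with \<open>h (l k) = (h\<^sub>2 l)(h\<^sub>1 k)\<close> and
    \<open>h 1 = \<epsilon>(h) 1\<close>, it is coassociativity of the coaction (\<open>yang_baxter_braid_fuse\<close>, used for \<open>H\<close>
    and \<open>M\<close> with \<open>A = D\<close>).
  \<^item> On \<open>(H, M, X)\<close> it is the Yetter-Drinfel'd condition acting on \<open>x\<close>
    (\<open>yang_baxter_yetter_drinfeld\<close>, used for \<open>X = D\<close>).
  \<^item> The instances that contain \<open>M\<close> more than once hold because \<open>\<sigma>\<^sub>M\<^sub>,\<^sub>M\<close> is the identity.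

  Both sides of a Yang-Baxter equation are linear, so they are compared on pure tensors
  \<open>(u \<otimes> v) \<otimes> w\<close>. Sweedler sums are made concrete by choosing, for every tensor, a list of pure
  tensors that add up to it (\<open>tparts\<close>). A linear map can be moved into such a list sum whatever
  the summand is, whereas turning an identity between tensors, such as coassociativity, into an
  identity between sums requires the summand to be multilinear.
\<close>


section \<open>Linear maps and list sums\<close>

lemma linD:
  assumes "lin V W f"
  shows lin_mem: "x \<in> carr V \<Longrightarrow> f x \<in> carr W"
    and lin_add: "x \<in> carr V \<Longrightarrow> y \<in> carr V \<Longrightarrow> f (x + y) = f x + f y"
    and lin_scl: "x \<in> carr V \<Longrightarrow> f (scl V c x) = scl W c (f x)"
  using assms unfolding lin_def by blast+

lemma lin_zero:
  assumes "is_vspace V" "lin V W f"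
  shows "f 0 = 0"
  using lin_add[OF assms(2), of 0 0] is_vspaceD(1)[OF assms(1)] by simp

lemma lin_id: "lin V V id"
  by (simp add: lin_def)

lemma lin_comp: "lin V W f \<Longrightarrow> lin W X g \<Longrightarrow> lin V X (\<lambda>x. g (f x))"
  unfolding lin_def Pi_iff by simp

lemma lin_cong:
  assumes V: "is_vspace V" and eq: "\<And>x. x \<in> carr V \<Longrightarrow> f x = g x"
  shows "lin V W f \<longleftrightarrow> lin V W g"
  by (simp add: lin_def Pi_iff eq is_vspaceD[OF V] cong: conj_cong ball_cong)

lemma sum_list_mem:
  assumes "is_vspace V" "\<And>a b. (a, b) \<in> set ts \<Longrightarrow> f a b \<in> carr V"
  shows "(\<Sum>(a, b)\<leftarrow>ts. f a b) \<in> carr V"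
  using assms(2) by (induction ts) (auto simp: is_vspaceD[OF assms(1)] simp del: plus_fun_apply zero_fun_apply)

lemma sum_list_pair_cong:
  assumes "\<And>a b. (a, b) \<in> set ts \<Longrightarrow> f a b = g a b"
  shows "(\<Sum>(a, b)\<leftarrow>ts. f a b) = (\<Sum>(a, b)\<leftarrow>ts. g a b)"
  using assms by (intro arg_cong[of _ _ sum_list] map_cong) auto

lemma sum_list_pair_swap:
  fixes f :: "'a \<Rightarrow> 'b \<Rightarrow> 'c \<Rightarrow> 'd \<Rightarrow> 'e::comm_monoid_add"
  shows "(\<Sum>(a, b)\<leftarrow>ts. \<Sum>(c, d)\<leftarrow>us. f a b c d) = (\<Sum>(c, d)\<leftarrow>us. \<Sum>(a, b)\<leftarrow>ts. f a b c d)"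
proof (induction ts)
  case Nil
  show ?case by (induction us) auto
next
  case (Cons t ts)
  then show ?case by (simp add: split_beta sum_list_addf)
qed

lemma sum_list_fun_apply: "(\<Sum>(a, b)\<leftarrow>ts. f a b) x = (\<Sum>(a, b)\<leftarrow>ts. f a b x)"
  by (induction ts) auto

lemma lin_sum_list:
  assumes "is_vspace V" "lin V W g" "\<And>a b. (a, b) \<in> set ts \<Longrightarrow> f a b \<in> carr V"
  shows "g (\<Sum>(a, b)\<leftarrow>ts. f a b) = (\<Sum>(a, b)\<leftarrow>ts. g (f a b))"
  using assms(3)
proof (induction ts)
  case Nil
  show ?case using lin_zero[OF assms(1,2)] by simp
next
  case (Cons t ts)
  obtain a b where t: "t = (a, b)" by (cases t)
  have "(\<Sum>(a, b)\<leftarrow>ts. f a b) \<in> carr V"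
    by (rule sum_list_mem[OF assms(1)]) (use Cons in auto)
  then show ?case using Cons by (simp add: t lin_add[OF assms(2)] del: plus_fun_apply)
qed

lemma lin_sum_list2:
  assumes V: "is_vspace V" and g: "lin V W g"
    and mem: "\<And>a b c d. (a, b) \<in> set ts \<Longrightarrow> (c, d) \<in> set (us a b) \<Longrightarrow> f a b c d \<in> carr V"
  shows "g (\<Sum>(a, b)\<leftarrow>ts. \<Sum>(c, d)\<leftarrow>us a b. f a b c d) = (\<Sum>(a, b)\<leftarrow>ts. \<Sum>(c, d)\<leftarrow>us a b. g (f a b c d))"
proof -
  have "g (\<Sum>(a, b)\<leftarrow>ts. \<Sum>(c, d)\<leftarrow>us a b. f a b c d) = (\<Sum>(a, b)\<leftarrow>ts. g (\<Sum>(c, d)\<leftarrow>us a b. f a b c d))"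
    by (rule lin_sum_list[OF V g], rule sum_list_mem[OF V], rule mem)
  also have "\<dots> = (\<Sum>(a, b)\<leftarrow>ts. \<Sum>(c, d)\<leftarrow>us a b. g (f a b c d))"
    by (rule sum_list_pair_cong, rule lin_sum_list[OF V g], rule mem)
  finally show ?thesis .
qed

lemma lin_sum_list_fun:
  assumes W: "is_vspace W" and f: "\<And>a b. (a, b) \<in> set ts \<Longrightarrow> lin V W (f a b)"
  shows "lin V W (\<lambda>x. \<Sum>(a, b)\<leftarrow>ts. f a b x)"
  using f
proof (induction ts)
  case Nil
  show ?case by (simp add: lin_def is_vspaceD[OF W])
next
  case (Cons t ts)
  obtain a b where t: "t = (a, b)" by (cases t)
  have f: "lin V W (f a b)" and s: "lin V W (\<lambda>x. \<Sum>(a, b)\<leftarrow>ts. f a b x)"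
    using Cons by (auto simp: t)
  have "lin V W (\<lambda>x. f a b x + (\<Sum>(a, b)\<leftarrow>ts. f a b x))"
    by (simp add: lin_def Pi_iff is_vspaceD[OF W] linD[OF f] linD[OF s] add_ac del: plus_fun_apply)
  then show ?case by (simp add: t)
qed

lemma bilin_lin_left: "bilin V W X f \<Longrightarrow> w \<in> carr W \<Longrightarrow> lin V X (\<lambda>v. f v w)"
  and bilin_lin_right: "bilin V W X f \<Longrightarrow> v \<in> carr V \<Longrightarrow> lin W X (f v)"
  by (auto simp: bilin_def)

lemma bilin_mem: "bilin V W X f \<Longrightarrow> v \<in> carr V \<Longrightarrow> w \<in> carr W \<Longrightarrow> f v w \<in> carr X"
  by (simp add: bilin_iff)

lemma bilin_pre:
  assumes "lin V V' f" "lin W W' g" "bilin V' W' X b"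
  shows "bilin V W X (\<lambda>v w. b (f v) (g w))"
  using assms by (auto simp: bilin_def lin_mem intro: lin_comp)

lemma bilin_post: "lin X Y g \<Longrightarrow> bilin V W X b \<Longrightarrow> bilin V W Y (\<lambda>v w. g (b v w))"
  by (auto simp: bilin_def intro: lin_comp)

lemma bilin_flip: "bilin V W X f \<Longrightarrow> bilin W V X (\<lambda>w v. f v w)"
  by (auto simp: bilin_def)

lemmas lin_tens_left = bilin_lin_left[OF bilin_tens]
  and lin_tens_right = bilin_lin_right[OF bilin_tens]


section \<open>Expanding tensors into pure tensors\<close>

text \<open>The choice is not linear in \<open>T\<close>; only sums over it of a bilinear expression are meaningful.\<close>

definition tparts :: "('k::field, 'v::ab_group_add) vspace \<Rightarrow> ('k, 'w::ab_group_add) vspace \<Rightarrow>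
    ('k, 'v, 'w) tensor \<Rightarrow> ('v \<times> 'w) list" where
  "tparts V W T = (SOME ts. set ts \<subseteq> carr V \<times> carr W \<and> T = (\<Sum>(v, w)\<leftarrow>ts. v \<otimes>\<^bsub>V,W\<^esub> w))"

lemma tparts:
  assumes "is_vspace V" "T \<in> carr (V \<Otimes> W)"
  shows tparts_subset: "set (tparts V W T) \<subseteq> carr V \<times> carr W"
    and sum_tparts: "(\<Sum>(v, w)\<leftarrow>tparts V W T. v \<otimes>\<^bsub>V,W\<^esub> w) = T"
  using someI_ex[OF tprod_decomp[OF assms]] unfolding tparts_def by auto

lemma tparts_mem:
  assumes "is_vspace V" "T \<in> carr (V \<Otimes> W)" "(v, w) \<in> set (tparts V W T)"
  shows "v \<in> carr V" "w \<in> carr W"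
  using tparts_subset[OF assms(1,2)] assms(3) by auto

lemma tsum_tparts:
  assumes "is_vspace V" "is_vspace X" "bilin V W X f" "T \<in> carr (V \<Otimes> W)"
  shows "tsum V W T f = (\<Sum>(v, w)\<leftarrow>tparts V W T. f v w)"
  using tsum_eq[OF assms(2,3) tparts_subset[OF assms(1,4)]] by (simp add: sum_tparts[OF assms(1,4)])

lemma lin_tparts:
  assumes "is_vspace V" "lin (V \<Otimes> W) X g" "T \<in> carr (V \<Otimes> W)"
  shows "g T = (\<Sum>(v, w)\<leftarrow>tparts V W T. g (v \<otimes>\<^bsub>V,W\<^esub> w))"
proof -
  have "g (\<Sum>(v, w)\<leftarrow>tparts V W T. v \<otimes>\<^bsub>V,W\<^esub> w) = (\<Sum>(v, w)\<leftarrow>tparts V W T. g (v \<otimes>\<^bsub>V,W\<^esub> w))"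
    by (rule lin_sum_list[OF is_vspace_tprod assms(2)])
      (use tparts_mem[OF assms(1,3)] in \<open>auto intro: tens_in_tprod\<close>)
  then show ?thesis by (simp add: sum_tparts[OF assms(1,3)])
qed

definition trilin :: "('k::field, 'u::ab_group_add) vspace \<Rightarrow> ('k, 'v::ab_group_add) vspace \<Rightarrow>
    ('k, 'w::ab_group_add) vspace \<Rightarrow> ('k, 'x::ab_group_add) vspace \<Rightarrow> ('u \<Rightarrow> 'v \<Rightarrow> 'w \<Rightarrow> 'x) \<Rightarrow> bool" where
  "trilin U V W X F \<longleftrightarrow> (\<forall>u\<in>carr U. bilin V W X (F u)) \<and>
     (\<forall>v\<in>carr V. \<forall>w\<in>carr W. lin U X (\<lambda>u. F u v w))"

lemma trilinD:
  assumes "trilin U V W X F"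
  shows trilin_bilin1: "u \<in> carr U \<Longrightarrow> bilin V W X (F u)"
    and trilin_bilin2: "v \<in> carr V \<Longrightarrow> bilin U W X (\<lambda>u w. F u v w)"
    and trilin_bilin3: "w \<in> carr W \<Longrightarrow> bilin U V X (\<lambda>u v. F u v w)"
  using assms by (auto simp: trilin_def bilin_def)

lemma trilinI:
  assumes "\<And>u. u \<in> carr U \<Longrightarrow> bilin V W X (F u)"
    and "\<And>v w. v \<in> carr V \<Longrightarrow> w \<in> carr W \<Longrightarrow> lin U X (\<lambda>u. F u v w)"
  shows "trilin U V W X F"
  using assms by (simp add: trilin_def)

text \<open>
  Contracting two arguments of a trilinear map with a tensor leaves a bilinear map. This is how
  linear maps out of iterated tensor products arise. Linearity in the tensor is the universal
  property; in the remaining argument the contraction is a finite sum of linear maps.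
\<close>

lemma bilin_tsum_left:
  assumes U: "is_vspace U" and W: "is_vspace W" and X: "is_vspace X" and F: "trilin U V W X F"
  shows "bilin (U \<Otimes> V) W X (\<lambda>T w. tsum U V T (\<lambda>u v. F u v w))"
  unfolding bilin_def
proof (intro conjI ballI)
  fix w assume w: "w \<in> carr W"
  show "lin (U \<Otimes> V) X (\<lambda>T. tsum U V T (\<lambda>u v. F u v w))"
    by (rule lin_tsum[OF U X trilin_bilin3[OF F w]])
next
  fix T assume T: "T \<in> carr (U \<Otimes> V)"
  have eq: "tsum U V T (\<lambda>u v. F u v w) = (\<Sum>(u, v)\<leftarrow>tparts U V T. F u v w)" if "w \<in> carr W" for w
    by (rule tsum_tparts[OF U X trilin_bilin3[OF F that] T])
  have "lin W X (F u v)" if "u \<in> carr U" "v \<in> carr V" for u v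
    using bilin_lin_right[OF trilin_bilin1[OF F]] that .
  then have l: "lin W X (\<lambda>w. \<Sum>(u, v)\<leftarrow>tparts U V T. F u v w)"
    by (intro lin_sum_list_fun[OF X]) (use tparts_mem[OF U T] in blast)
  show "lin W X (\<lambda>w. tsum U V T (\<lambda>u v. F u v w))"
    using l by (simp add: lin_cong[OF W eq])
qed

lemma bilin_tsum_right:
  assumes U: "is_vspace U" and V: "is_vspace V" and X: "is_vspace X" and F: "trilin U V W X F"
  shows "bilin U (V \<Otimes> W) X (\<lambda>u T. tsum V W T (F u))"
  unfolding bilin_def
proof (intro conjI ballI)
  fix u assume u: "u \<in> carr U"
  show "lin (V \<Otimes> W) X (\<lambda>T. tsum V W T (F u))"
    by (rule lin_tsum[OF V X trilin_bilin1[OF F u]])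
next
  fix T assume T: "T \<in> carr (V \<Otimes> W)"
  have eq: "tsum V W T (F u) = (\<Sum>(v, w)\<leftarrow>tparts V W T. F u v w)" if "u \<in> carr U" for u
    by (rule tsum_tparts[OF V X trilin_bilin1[OF F that] T])
  have "lin U X (\<lambda>u. F u v w)" if "v \<in> carr V" "w \<in> carr W" for v w
    using F that by (simp add: trilin_def)
  then have l: "lin U X (\<lambda>u. \<Sum>(v, w)\<leftarrow>tparts V W T. F u v w)"
    by (intro lin_sum_list_fun[OF X]) (use tparts_mem[OF V T] in blast)
  show "lin U X (\<lambda>u. tsum V W T (F u))"
    using l by (simp add: lin_cong[OF U eq])
qed


text \<open>
  The Sweedler sums of the axioms are nested. Here the tensor of the inner sum is constant and the
  outer sum runs over parameters of the summand, as in the formula for \<open>\<Delta> (a * b)\<close>.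
\<close>

lemma bilin_tsum_param:
  assumes U: "is_vspace U" and V: "is_vspace V" and P: "is_vspace P" and X: "is_vspace X"
    and T: "T \<in> carr (P \<Otimes> Q)"
    and F: "\<And>u v. u \<in> carr U \<Longrightarrow> v \<in> carr V \<Longrightarrow> bilin P Q X (F u v)"
    and G: "\<And>p q. p \<in> carr P \<Longrightarrow> q \<in> carr Q \<Longrightarrow> bilin U V X (\<lambda>u v. F u v p q)"
  shows "bilin U V X (\<lambda>u v. tsum P Q T (F u v))"
proof -
  have eq: "tsum P Q T (F u v) = (\<Sum>(p, q)\<leftarrow>tparts P Q T. F u v p q)"
    if "u \<in> carr U" "v \<in> carr V" for u v
    by (rule tsum_tparts[OF P X F[OF that] T])
  have "lin V X (\<lambda>v. tsum P Q T (F u v))" if u: "u \<in> carr U" for u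
    by (rule lin_cong[THEN iffD2, OF V eq[OF u]], assumption, rule lin_sum_list_fun[OF X]) (use tparts_mem[OF P T] bilin_lin_right[OF G u] in blast)
  moreover have "lin U X (\<lambda>u. tsum P Q T (F u v))" if v: "v \<in> carr V" for v
    by (rule lin_cong[THEN iffD2, OF U eq[OF _ v]], assumption, rule lin_sum_list_fun[OF X]) (use tparts_mem[OF P T] bilin_lin_left[OF G v] in blast)
  ultimately show ?thesis by (simp add: bilin_def)
qed

lemma lin_tsum_push:
  assumes V: "is_vspace V" and X: "is_vspace X" and Y: "is_vspace Y"
    and g: "lin X Y g" and f: "bilin V W X f" and T: "T \<in> carr (V \<Otimes> W)"
  shows "g (tsum V W T f) = tsum V W T (\<lambda>v w. g (f v w))"
  unfolding tsum_tparts[OF V X f T] tsum_tparts[OF V Y bilin_post[OF g f] T]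
  by (rule lin_sum_list[OF X g]) (use tparts_mem[OF V T] bilin_mem[OF f] in blast)


section \<open>Tensor products of maps and the colored Yang-Baxter equation\<close>

lemma trilin_tens_right:
  "trilin U V W (U \<Otimes> V \<Otimes> W) (\<lambda>u v w. u \<otimes>\<^bsub>U,V \<Otimes> W\<^esub> (v \<otimes>\<^bsub>V,W\<^esub> w))"
  by (intro trilinI bilin_post[OF lin_tens_right] bilin_tens lin_tens_left tens_in_tprod)

lemma trilin_tens_left:
  "trilin U V W ((U \<Otimes> V) \<Otimes> W) (\<lambda>u v w. (u \<otimes>\<^bsub>U,V\<^esub> v) \<otimes>\<^bsub>U \<Otimes> V,W\<^esub> w)"
  by (intro trilinI bilin_pre[OF lin_tens_right lin_id[unfolded id_def] bilin_tens]
      lin_comp[OF lin_tens_left lin_tens_left])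

lemma bilin_tmap:
  assumes "lin V V' f" "lin W W' g"
  shows "bilin V W (V' \<Otimes> W') (\<lambda>v w. f v \<otimes>\<^bsub>V',W'\<^esub> g w)"
  by (rule bilin_pre[OF assms bilin_tens])

lemma lin_tmap:
  assumes "is_vspace V" "lin V V' f" "lin W W' g"
  shows "lin (V \<Otimes> W) (V' \<Otimes> W') (tmap V W V' W' f g)"
  unfolding tmap_def by (rule lin_tsum[OF assms(1) is_vspace_tprod bilin_tmap[OF assms(2,3)]])

lemma tmap_tens:
  assumes "lin V V' f" "lin W W' g" "v \<in> carr V" "w \<in> carr W"
  shows "tmap V W V' W' f g (v \<otimes>\<^bsub>V,W\<^esub> w) = f v \<otimes>\<^bsub>V',W'\<^esub> g w"
  unfolding tmap_def by (rule tsum_tens[OF is_vspace_tprod bilin_tmap[OF assms(1,2)] assms(3,4)])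

context
  fixes U :: "('k::field, 'u::ab_group_add) vspace" and V :: "('k, 'v::ab_group_add) vspace"
    and W :: "('k, 'w::ab_group_add) vspace"
  assumes U: "is_vspace U" and V: "is_vspace V" and W: "is_vspace W"
begin

lemma lin_assoc_r: "lin ((U \<Otimes> V) \<Otimes> W) (U \<Otimes> V \<Otimes> W) (assoc_r U V W)"
  unfolding assoc_r_def
  by (intro lin_tsum bilin_tsum_left is_vspace_tprod trilin_tens_right U W)

lemma lin_assoc_l: "lin (U \<Otimes> V \<Otimes> W) ((U \<Otimes> V) \<Otimes> W) (assoc_l U V W)"
  unfolding assoc_l_def
  by (intro lin_tsum bilin_tsum_right is_vspace_tprod trilin_tens_left U V)

text \<open>
  The left factor is an arbitrary tensor: coassociativity applies the associator to
  \<open>\<delta> a \<otimes> h\<close>.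
\<close>

lemma assoc_r_tens_tensor:
  assumes T: "T \<in> carr (U \<Otimes> V)" and w: "w \<in> carr W"
  shows "assoc_r U V W (T \<otimes>\<^bsub>U \<Otimes> V,W\<^esub> w) = tsum U V T (\<lambda>u v. u \<otimes>\<^bsub>U,V \<Otimes> W\<^esub> (v \<otimes>\<^bsub>V,W\<^esub> w))"
  unfolding assoc_r_def
  by (rule tsum_tens[OF is_vspace_tprod bilin_tsum_left[OF U W is_vspace_tprod trilin_tens_right] T w])

lemma assoc_r_tens:
  assumes "u \<in> carr U" "v \<in> carr V" "w \<in> carr W"
  shows "assoc_r U V W ((u \<otimes>\<^bsub>U,V\<^esub> v) \<otimes>\<^bsub>U \<Otimes> V,W\<^esub> w) = u \<otimes>\<^bsub>U,V \<Otimes> W\<^esub> (v \<otimes>\<^bsub>V,W\<^esub> w)"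
  unfolding assoc_r_tens_tensor[OF tens_in_tprod[OF assms(1,2)] assms(3)]
  by (rule tsum_tens[OF is_vspace_tprod trilin_bilin3[OF trilin_tens_right assms(3)] assms(1,2)])

lemma assoc_l_tens:
  assumes "u \<in> carr U" "v \<in> carr V" "w \<in> carr W"
  shows "assoc_l U V W (u \<otimes>\<^bsub>U,V \<Otimes> W\<^esub> (v \<otimes>\<^bsub>V,W\<^esub> w)) = (u \<otimes>\<^bsub>U,V\<^esub> v) \<otimes>\<^bsub>U \<Otimes> V,W\<^esub> w"
proof -
  have "assoc_l U V W (u \<otimes>\<^bsub>U,V \<Otimes> W\<^esub> (v \<otimes>\<^bsub>V,W\<^esub> w)) =
      tsum V W (v \<otimes>\<^bsub>V,W\<^esub> w) (\<lambda>v w. (u \<otimes>\<^bsub>U,V\<^esub> v) \<otimes>\<^bsub>U \<Otimes> V,W\<^esub> w)"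
    unfolding assoc_l_def
    by (rule tsum_tens[OF is_vspace_tprod bilin_tsum_right[OF U V is_vspace_tprod trilin_tens_left]
          assms(1) tens_in_tprod[OF assms(2,3)]])
  also have "\<dots> = (u \<otimes>\<^bsub>U,V\<^esub> v) \<otimes>\<^bsub>U \<Otimes> V,W\<^esub> w"
    by (rule tsum_tens[OF is_vspace_tprod trilin_bilin1[OF trilin_tens_left assms(1)] assms(2,3)])
  finally show ?thesis .
qed

text \<open>This reduces Yang-Baxter equations to pure tensors.\<close>

lemma lin_eq_on_tprod3:
  assumes g: "lin ((U \<Otimes> V) \<Otimes> W) X g" and h: "lin ((U \<Otimes> V) \<Otimes> W) X h"
    and eq: "\<And>u v w. u \<in> carr U \<Longrightarrow> v \<in> carr V \<Longrightarrow> w \<in> carr W \<Longrightarrow>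
      g ((u \<otimes>\<^bsub>U,V\<^esub> v) \<otimes>\<^bsub>U \<Otimes> V,W\<^esub> w) = h ((u \<otimes>\<^bsub>U,V\<^esub> v) \<otimes>\<^bsub>U \<Otimes> V,W\<^esub> w)"
    and T: "T \<in> carr ((U \<Otimes> V) \<Otimes> W)"
  shows "g T = h T"
proof (rule lin_eq_on_tprod[OF is_vspace_tprod g h _ T])
  fix S w assume S: "S \<in> carr (U \<Otimes> V)" and w: "w \<in> carr W"
  show "g (S \<otimes>\<^bsub>U \<Otimes> V,W\<^esub> w) = h (S \<otimes>\<^bsub>U \<Otimes> V,W\<^esub> w)"
    by (rule lin_eq_on_tprod[OF U lin_comp[OF lin_tens_left[OF w] g] lin_comp[OF lin_tens_left[OF w] h]
          eq[OF _ _ w] S])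
qed

lemma lin_on_left:
  assumes "lin (U \<Otimes> V) (V \<Otimes> U) f"
  shows "lin ((U \<Otimes> V) \<Otimes> W) ((V \<Otimes> U) \<Otimes> W) (on_left U V W f)"
  unfolding on_left_def by (rule lin_tmap[OF is_vspace_tprod assms lin_id])

lemma on_left_tens:
  assumes "lin (U \<Otimes> V) (V \<Otimes> U) f" "u \<in> carr U" "v \<in> carr V" "w \<in> carr W"
  shows "on_left U V W f ((u \<otimes>\<^bsub>U,V\<^esub> v) \<otimes>\<^bsub>U \<Otimes> V,W\<^esub> w) = f (u \<otimes>\<^bsub>U,V\<^esub> v) \<otimes>\<^bsub>V \<Otimes> U,W\<^esub> w"
  unfolding on_left_def using tmap_tens[OF assms(1) lin_id tens_in_tprod assms(4)] assms by simp

end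

lemma lin_on_right:
  assumes U: "is_vspace U" and V: "is_vspace V" and W: "is_vspace W"
    and f: "lin (V \<Otimes> W) (W \<Otimes> V) f"
  shows "lin ((U \<Otimes> V) \<Otimes> W) ((U \<Otimes> W) \<Otimes> V) (on_right U V W f)"
  unfolding on_right_def comp_def
  by (rule lin_comp[OF lin_comp[OF lin_assoc_r[OF U V W] lin_tmap[OF U lin_id f]] lin_assoc_l[OF U W V]])

lemma on_right_tens:
  assumes U: "is_vspace U" and V: "is_vspace V" and W: "is_vspace W"
    and f: "lin (V \<Otimes> W) (W \<Otimes> V) f"
    and u: "u \<in> carr U" and v: "v \<in> carr V" and w: "w \<in> carr W"
  shows "on_right U V W f ((u \<otimes>\<^bsub>U,V\<^esub> v) \<otimes>\<^bsub>U \<Otimes> V,W\<^esub> w) =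
    assoc_l U W V (u \<otimes>\<^bsub>U,W \<Otimes> V\<^esub> f (v \<otimes>\<^bsub>V,W\<^esub> w))"
  by (simp add: on_right_def assoc_r_tens[OF U V W u v w] tmap_tens[OF lin_id f u tens_in_tprod[OF v w]])

lemma colored_yang_baxterI:
  assumes U: "is_vspace U" and V: "is_vspace V" and W: "is_vspace W"
    and \<sigma>UV: "lin (U \<Otimes> V) (V \<Otimes> U) \<sigma>UV" and \<sigma>UW: "lin (U \<Otimes> W) (W \<Otimes> U) \<sigma>UW"
    and \<sigma>VW: "lin (V \<Otimes> W) (W \<Otimes> V) \<sigma>VW"
    and eq: "\<And>u v w. u \<in> carr U \<Longrightarrow> v \<in> carr V \<Longrightarrow> w \<in> carr W \<Longrightarrow>
      on_left V W U \<sigma>VW (on_right V U W \<sigma>UW (on_left U V W \<sigma>UV ((u \<otimes>\<^bsub>U,V\<^esub> v) \<otimes>\<^bsub>U \<Otimes> V,W\<^esub> w))) =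
      on_right W U V \<sigma>UV (on_left U W V \<sigma>UW (on_right U V W \<sigma>VW ((u \<otimes>\<^bsub>U,V\<^esub> v) \<otimes>\<^bsub>U \<Otimes> V,W\<^esub> w)))"
  shows "colored_yang_baxter U V W \<sigma>UV \<sigma>UW \<sigma>VW"
  unfolding colored_yang_baxter_def comp_def
proof
  fix T assume T: "T \<in> carr ((U \<Otimes> V) \<Otimes> W)"
  note l = lin_on_left and r = lin_on_right
  have g: "lin ((U \<Otimes> V) \<Otimes> W) ((W \<Otimes> V) \<Otimes> U)
      (\<lambda>T. on_left V W U \<sigma>VW (on_right V U W \<sigma>UW (on_left U V W \<sigma>UV T)))"
    by (intro lin_comp[OF lin_comp[OF l[OF U V W \<sigma>UV] r[OF V U W \<sigma>UW]] l[OF V W U \<sigma>VW]])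
  have h: "lin ((U \<Otimes> V) \<Otimes> W) ((W \<Otimes> V) \<Otimes> U)
      (\<lambda>T. on_right W U V \<sigma>UV (on_left U W V \<sigma>UW (on_right U V W \<sigma>VW T)))"
    by (intro lin_comp[OF lin_comp[OF r[OF U V W \<sigma>VW] l[OF U W V \<sigma>UW]] r[OF W U V \<sigma>UV]])
  show "on_left V W U \<sigma>VW (on_right V U W \<sigma>UW (on_left U V W \<sigma>UV T)) =
      on_right W U V \<sigma>UV (on_left U W V \<sigma>UW (on_right U V W \<sigma>VW T))"
    by (rule lin_eq_on_tprod3[OF U V W g h _ T]) (rule eq)
qed

text \<open>
  One step of a computation on pure tensors: once the value of \<open>f\<close> on a pure tensor is expanded,
  the bracketing and the spectator factor can be dealt with termwise.
\<close>

lemma on_left_sum: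
  assumes U: "is_vspace U" and V: "is_vspace V" and W: "is_vspace W"
    and f: "lin (U \<Otimes> V) (V \<Otimes> U) f"
    and u: "u \<in> carr U" and v: "v \<in> carr V" and w: "w \<in> carr W"
    and mem: "\<And>a b. (a, b) \<in> set ts \<Longrightarrow> p a b \<in> carr V \<and> q a b \<in> carr U"
    and eq: "f (u \<otimes>\<^bsub>U,V\<^esub> v) = (\<Sum>(a, b)\<leftarrow>ts. p a b \<otimes>\<^bsub>V,U\<^esub> q a b)"
  shows "on_left U V W f ((u \<otimes>\<^bsub>U,V\<^esub> v) \<otimes>\<^bsub>U \<Otimes> V,W\<^esub> w) =
    (\<Sum>(a, b)\<leftarrow>ts. (p a b \<otimes>\<^bsub>V,U\<^esub> q a b) \<otimes>\<^bsub>V \<Otimes> U,W\<^esub> w)"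
  unfolding on_left_tens[OF U V W f u v w] eq
  by (rule lin_sum_list[OF is_vspace_tprod lin_tens_left[OF w]]) (use mem in \<open>auto intro: tens_in_tprod\<close>)

lemma on_right_sum:
  assumes U: "is_vspace U" and V: "is_vspace V" and W: "is_vspace W"
    and f: "lin (V \<Otimes> W) (W \<Otimes> V) f"
    and u: "u \<in> carr U" and v: "v \<in> carr V" and w: "w \<in> carr W"
    and mem: "\<And>a b. (a, b) \<in> set ts \<Longrightarrow> p a b \<in> carr W \<and> q a b \<in> carr V"
    and eq: "f (v \<otimes>\<^bsub>V,W\<^esub> w) = (\<Sum>(a, b)\<leftarrow>ts. p a b \<otimes>\<^bsub>W,V\<^esub> q a b)"
  shows "on_right U V W f ((u \<otimes>\<^bsub>U,V\<^esub> v) \<otimes>\<^bsub>U \<Otimes> V,W\<^esub> w) =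
    (\<Sum>(a, b)\<leftarrow>ts. (u \<otimes>\<^bsub>U,W\<^esub> p a b) \<otimes>\<^bsub>U \<Otimes> W,V\<^esub> q a b)"
proof -
  have "on_right U V W f ((u \<otimes>\<^bsub>U,V\<^esub> v) \<otimes>\<^bsub>U \<Otimes> V,W\<^esub> w) =
      (\<Sum>(a, b)\<leftarrow>ts. assoc_l U W V (u \<otimes>\<^bsub>U,W \<Otimes> V\<^esub> (p a b \<otimes>\<^bsub>W,V\<^esub> q a b)))"
    unfolding on_right_tens[OF U V W f u v w] eq
    by (rule lin_sum_list[OF is_vspace_tprod lin_comp[OF lin_tens_right[OF u] lin_assoc_l[OF U W V]]])
      (use mem in \<open>auto intro: tens_in_tprod\<close>)
  also have "\<dots> = (\<Sum>(a, b)\<leftarrow>ts. (u \<otimes>\<^bsub>U,W\<^esub> p a b) \<otimes>\<^bsub>U \<Otimes> W,V\<^esub> q a b)"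
    by (rule sum_list_pair_cong) (use mem assoc_l_tens[OF U W V u] in blast)
  finally show ?thesis .
qed

lemma on_right_pure:
  assumes "is_vspace U" "is_vspace V" "is_vspace W" "lin (V \<Otimes> W) (W \<Otimes> V) f"
    and "u \<in> carr U" "v \<in> carr V" "w \<in> carr W" "p \<in> carr W" "q \<in> carr V"
    and "f (v \<otimes>\<^bsub>V,W\<^esub> w) = p \<otimes>\<^bsub>W,V\<^esub> q"
  shows "on_right U V W f ((u \<otimes>\<^bsub>U,V\<^esub> v) \<otimes>\<^bsub>U \<Otimes> V,W\<^esub> w) = (u \<otimes>\<^bsub>U,W\<^esub> p) \<otimes>\<^bsub>U \<Otimes> W,V\<^esub> q"
  using on_right_sum[OF assms(1-7), of "[(p, q)]" "\<lambda>p q. p" "\<lambda>p q. q"] assms(8-10) by simp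

lemma on_left_id:
  assumes U: "is_vspace U" and W: "is_vspace W"
    and f: "\<And>u v. u \<in> carr U \<Longrightarrow> v \<in> carr U \<Longrightarrow> f (u \<otimes>\<^bsub>U,U\<^esub> v) = u \<otimes>\<^bsub>U,U\<^esub> v"
    and l: "lin (U \<Otimes> U) (U \<Otimes> U) f" and T: "T \<in> carr ((U \<Otimes> U) \<Otimes> W)"
  shows "on_left U U W f T = T"
  using lin_eq_on_tprod3[OF U U W lin_on_left[OF U U W l] lin_id _ T]
  by (simp add: on_left_tens[OF U U W l] f)

lemma on_right_id:
  assumes U: "is_vspace U" and W: "is_vspace W"
    and f: "\<And>u v. u \<in> carr U \<Longrightarrow> v \<in> carr U \<Longrightarrow> f (u \<otimes>\<^bsub>U,U\<^esub> v) = u \<otimes>\<^bsub>U,U\<^esub> v"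
    and l: "lin (U \<Otimes> U) (U \<Otimes> U) f" and T: "T \<in> carr ((W \<Otimes> U) \<Otimes> U)"
  shows "on_right W U U f T = T"
  using lin_eq_on_tprod3[OF W U U lin_on_right[OF W U U l] lin_id _ T]
  by (simp add: on_right_pure[OF W U U l _ _ _ _ _ f])

text \<open>
  If one of the three braidings is the identity, the two sides become the same composite of the
  other two.
\<close>

lemma yang_baxter_id_last:
  assumes U: "is_vspace U" and V: "is_vspace V" and f: "lin (U \<Otimes> V) (V \<Otimes> U) f"
    and g: "\<And>v w. v \<in> carr V \<Longrightarrow> w \<in> carr V \<Longrightarrow> g (v \<otimes>\<^bsub>V,V\<^esub> w) = v \<otimes>\<^bsub>V,V\<^esub> w"
    and l: "lin (V \<Otimes> V) (V \<Otimes> V) g"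
  shows "colored_yang_baxter U V V f f g"
  unfolding colored_yang_baxter_def comp_def
  using on_left_id[OF V U g l] on_right_id[OF V U g l]
    lin_mem[OF lin_comp[OF lin_on_left[OF U V V f] lin_on_right[OF V U V f]]] by simp

lemma yang_baxter_id_first:
  assumes U: "is_vspace U" and V: "is_vspace V" and f: "lin (U \<Otimes> V) (V \<Otimes> U) f"
    and g: "\<And>v w. v \<in> carr U \<Longrightarrow> w \<in> carr U \<Longrightarrow> g (v \<otimes>\<^bsub>U,U\<^esub> w) = v \<otimes>\<^bsub>U,U\<^esub> w"
    and l: "lin (U \<Otimes> U) (U \<Otimes> U) g"
  shows "colored_yang_baxter U U V g f f"
  unfolding colored_yang_baxter_def comp_def
  using on_left_id[OF U V g l] on_right_id[OF U V g l]
    lin_mem[OF lin_comp[OF lin_on_right[OF U U V f] lin_on_left[OF U V U f]]] by simp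


section \<open>Algebras\<close>

locale unital_algebra =
  fixes A :: "('k::field, 'a::ab_group_add) vspace" and mult :: "'a \<Rightarrow> 'a \<Rightarrow> 'a" and unit :: 'a
  assumes A: "is_vspace A"
    and mult_bilin: "bilin A A A mult"
    and unit_mem: "unit \<in> carr A"
    and mult_assoc: "a \<in> carr A \<Longrightarrow> b \<in> carr A \<Longrightarrow> c \<in> carr A \<Longrightarrow> mult (mult a b) c = mult a (mult b c)"
    and mult_unit_left: "a \<in> carr A \<Longrightarrow> mult unit a = a"
    and mult_unit_right: "a \<in> carr A \<Longrightarrow> mult a unit = a"
begin

text \<open>
  In general not invertible: the product of both factors is kept in one place, and the unit fills
  the other.
\<close>

definition fuse_left :: "('k, 'a, 'a) tensor \<Rightarrow> ('k, 'a, 'a) tensor" where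
  "fuse_left T = tsum A A T (\<lambda>a b. mult a b \<otimes>\<^bsub>A,A\<^esub> unit)"

definition fuse_right :: "('k, 'a, 'a) tensor \<Rightarrow> ('k, 'a, 'a) tensor" where
  "fuse_right T = tsum A A T (\<lambda>a b. unit \<otimes>\<^bsub>A,A\<^esub> mult a b)"

lemma lin_fuse_left: "lin (A \<Otimes> A) (A \<Otimes> A) fuse_left"
  and fuse_left_tens: "a \<in> carr A \<Longrightarrow> b \<in> carr A \<Longrightarrow> fuse_left (a \<otimes>\<^bsub>A,A\<^esub> b) = mult a b \<otimes>\<^bsub>A,A\<^esub> unit"
  using lin_tsum[OF A is_vspace_tprod bilin_post[OF lin_tens_left[OF unit_mem] mult_bilin]]
    tsum_tens[OF is_vspace_tprod bilin_post[OF lin_tens_left[OF unit_mem] mult_bilin]]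
  unfolding fuse_left_def by blast+

lemma lin_fuse_right: "lin (A \<Otimes> A) (A \<Otimes> A) fuse_right"
  and fuse_right_tens: "a \<in> carr A \<Longrightarrow> b \<in> carr A \<Longrightarrow> fuse_right (a \<otimes>\<^bsub>A,A\<^esub> b) = unit \<otimes>\<^bsub>A,A\<^esub> mult a b"
  using lin_tsum[OF A is_vspace_tprod bilin_post[OF lin_tens_right[OF unit_mem] mult_bilin]]
    tsum_tens[OF is_vspace_tprod bilin_post[OF lin_tens_right[OF unit_mem] mult_bilin]]
  unfolding fuse_right_def by blast+

lemma mult_mem: "a \<in> carr A \<Longrightarrow> b \<in> carr A \<Longrightarrow> mult a b \<in> carr A"
  by (rule bilin_mem[OF mult_bilin])

lemma yang_baxter_fuse_left: "colored_yang_baxter A A A fuse_left fuse_left fuse_left"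
  by (rule colored_yang_baxterI[OF A A A lin_fuse_left lin_fuse_left lin_fuse_left])
    (simp add: on_left_tens[OF A A A lin_fuse_left] on_right_pure[OF A A A lin_fuse_left _ _ _ _ _ fuse_left_tens]
      fuse_left_tens mult_mem unit_mem mult_assoc mult_unit_left)

lemma yang_baxter_fuse_right: "colored_yang_baxter A A A fuse_right fuse_right fuse_right"
  by (rule colored_yang_baxterI[OF A A A lin_fuse_right lin_fuse_right lin_fuse_right])
    (simp add: on_left_tens[OF A A A lin_fuse_right] on_right_pure[OF A A A lin_fuse_right _ _ _ _ _ fuse_right_tens]
      fuse_right_tens mult_mem unit_mem mult_assoc mult_unit_left mult_unit_right)

end

section \<open>Bialgebras, modules and comodules\<close>

locale H_comodule = bialgebra sH \<Delta> \<epsilon>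
  for sH :: "'k::field \<Rightarrow> 'h::ring_1 \<Rightarrow> 'h" and \<Delta> and \<epsilon> +
  fixes C :: "('k, 'c::ab_group_add) vspace" and \<delta> :: "'c \<Rightarrow> ('k, 'c, 'h) tensor"
  assumes C: "is_vspace C"
    and coact_lin: "lin C (C \<Otimes> full sH) \<delta>"
    and coact_coassoc: "c \<in> carr C \<Longrightarrow>
      assoc_r C (full sH) (full sH) (tmap C (full sH) (C \<Otimes> full sH) (full sH) \<delta> id (\<delta> c)) =
      tmap C (full sH) C (full sH \<Otimes> full sH) id \<Delta> (\<delta> c)"
    and coact_counit: "c \<in> carr C \<Longrightarrow> tsum C (full sH) (\<delta> c) (\<lambda>a h. scl C (\<epsilon> h) a) = c"

context bialgebra
begin

abbreviation "H \<equiv> full sH"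

lemma H: "is_vspace H"
  by (rule is_vspace_full) unfold_locales

lemma H_mem [simp]: "h \<in> carr H"
  by (simp add: full_def)

lemma bilin_mult: "bilin H H H (*)"
  by (simp add: bilin_iff full_def distrib_left distrib_right scale_mult_left flip: scale_mult_right)

lemma lin_mult_right: "lin H H (\<lambda>x. x * h)"
  by (rule bilin_lin_left[OF bilin_mult]) simp

lemma H_algebra: "unital_algebra H (*) 1"
  by standard (use H bilin_mult in \<open>auto simp: mult.assoc\<close>)

lemma H_comodule_H: "H_comodule sH \<Delta> \<epsilon> H \<Delta>"
proof
  show "tsum H H (\<Delta> h) (\<lambda>a h. scl H (\<epsilon> h) a) = h" for h
    using counit_right[of h] by (simp add: full_def)
qed (rule H comult_linear coassoc)+

abbreviation "\<Delta>parts h \<equiv> tparts H H (\<Delta> h)"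

lemma comult_mem: "\<Delta> h \<in> carr (H \<Otimes> H)"
  by (rule lin_mem[OF comult_linear]) simp

text \<open>
  Multiplicativity of \<open>\<Delta>\<close> with \<open>G\<close> applied to the two legs, which is the form in which it meets
  computations on pure tensors.
\<close>

lemma comult_mult_sum:
  assumes Y: "is_vspace Y" and G: "bilin H H Y G"
  shows "tsum H H (\<Delta> (a * b)) G =
    (\<Sum>(a1, a2)\<leftarrow>\<Delta>parts a. \<Sum>(b1, b2)\<leftarrow>\<Delta>parts b. G (a1 * b1) (a2 * b2))"
proof -
  let ?F = "\<lambda>a1 a2 b1 b2. (a1 * b1) \<otimes>\<^bsub>H,H\<^esub> (a2 * b2)"
  have l: "lin H H (\<lambda>x. x * h)" "lin H H (\<lambda>x. h * x)" for h
    by (rule lin_mult_right, rule bilin_lin_right[OF bilin_mult]) simp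
  have F1: "bilin H H (H \<Otimes> H) (?F a1 a2)" for a1 a2
    by (rule bilin_pre[OF l(2) l(2) bilin_tens])
  have F2: "bilin H H (H \<Otimes> H) (\<lambda>a1 a2. ?F a1 a2 b1 b2)" for b1 b2
    by (rule bilin_pre[OF l(1) l(1) bilin_tens])
  have inner: "tsum H H (\<Delta> b) (?F a1 a2) = (\<Sum>(b1, b2)\<leftarrow>\<Delta>parts b. ?F a1 a2 b1 b2)" for a1 a2
    by (rule tsum_tparts[OF H is_vspace_tprod F1 comult_mem])
  have mem: "?F a1 a2 b1 b2 \<in> carr (H \<Otimes> H)" for a1 a2 b1 b2
    by (rule tens_in_tprod) simp_all
  have comult: "\<Delta> (a * b) = (\<Sum>(a1, a2)\<leftarrow>\<Delta>parts a. \<Sum>(b1, b2)\<leftarrow>\<Delta>parts b. ?F a1 a2 b1 b2)"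
    unfolding comult_mult
    by (subst tsum_tparts[OF H is_vspace_tprod bilin_tsum_param[OF H H H is_vspace_tprod comult_mem F1 F2] comult_mem])
      (simp add: inner)
  note push = lin_sum_list[OF is_vspace_tprod lin_tsum[OF H Y G]]
  have inner_push: "tsum H H (\<Sum>(b1, b2)\<leftarrow>\<Delta>parts b. ?F a1 a2 b1 b2) G =
      (\<Sum>(b1, b2)\<leftarrow>\<Delta>parts b. G (a1 * b1) (a2 * b2))" for a1 a2
    by (subst push, rule mem) (simp add: tsum_tens[OF Y G])
  show ?thesis
    unfolding comult by (subst push, intro sum_list_mem is_vspace_tprod mem) (simp only: inner_push)
qed

end

context H_comodule
begin

abbreviation "\<delta>parts c \<equiv> tparts C H (\<delta> c)"

lemma coact_mem: "c \<in> carr C \<Longrightarrow> \<delta> c \<in> carr (C \<Otimes> H)"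
  by (rule lin_mem[OF coact_lin])

lemma coparts_mem: "c \<in> carr C \<Longrightarrow> (a, h) \<in> set (\<delta>parts c) \<Longrightarrow> a \<in> carr C"
  using tparts_mem(1)[OF C coact_mem] .

text \<open>
  Coassociativity as an exchange of Sweedler sums,
  \<open>F c\<^sub>0\<^sub>0 c\<^sub>0\<^sub>1 c\<^sub>1 = F c\<^sub>0 c\<^sub>1\<^sub>1 c\<^sub>1\<^sub>2\<close>: a trilinear \<open>F\<close> extends to a linear map \<open>\<Phi>\<close> on
  \<open>C \<otimes> (H \<otimes> H)\<close>, and \<open>\<Phi>\<close> is applied to the coassociativity equation.
\<close>

lemma coassoc_sum:
  assumes Y: "is_vspace Y" and F: "trilin C H H Y F" and c: "c \<in> carr C"
  shows "(\<Sum>(a, h)\<leftarrow>\<delta>parts c. \<Sum>(b, g)\<leftarrow>\<delta>parts a. F b g h) =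
    (\<Sum>(a, h)\<leftarrow>\<delta>parts c. \<Sum>(h1, h2)\<leftarrow>\<Delta>parts h. F a h1 h2)"
proof -
  define \<Phi> where "\<Phi> T = tsum C (H \<Otimes> H) T (\<lambda>a S. tsum H H S (F a))" for T
  note b = bilin_tsum_right[OF C H Y F]
  have \<Phi>: "lin (C \<Otimes> H \<Otimes> H) Y \<Phi>"
    unfolding \<Phi>_def by (rule lin_tsum[OF C Y b])
  have \<Phi>_tens: "\<Phi> (a \<otimes>\<^bsub>C,H \<Otimes> H\<^esub> S) = tsum H H S (F a)" if "a \<in> carr C" "S \<in> carr (H \<Otimes> H)" for a S
    unfolding \<Phi>_def by (rule tsum_tens[OF Y b that])
  have l: "\<Phi> (assoc_r C H H (tmap C H (C \<Otimes> H) H \<delta> id (\<delta> c))) =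
      (\<Sum>(a, h)\<leftarrow>\<delta>parts c. \<Sum>(b, g)\<leftarrow>\<delta>parts a. F b g h)" (is "?L (\<delta> c) = _")
  proof -
    have L: "lin (C \<Otimes> H) Y ?L"
      by (rule lin_comp[OF lin_comp[OF lin_tmap[OF C coact_lin lin_id] lin_assoc_r[OF C H H]] \<Phi>])
    have "?L (a \<otimes>\<^bsub>C,H\<^esub> h) = (\<Sum>(b, g)\<leftarrow>\<delta>parts a. F b g h)" if a: "a \<in> carr C" for a h
    proof -
      have "?L (a \<otimes>\<^bsub>C,H\<^esub> h) = \<Phi> (tsum C H (\<delta> a) (\<lambda>u v. u \<otimes>\<^bsub>C,H \<Otimes> H\<^esub> (v \<otimes>\<^bsub>H,H\<^esub> h)))"
        by (subst tmap_tens[OF coact_lin lin_id a H_mem])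
          (simp only: id_apply assoc_r_tens_tensor[OF C H H coact_mem[OF a] H_mem])
      also have "\<dots> = \<Phi> (\<Sum>(b, g)\<leftarrow>\<delta>parts a. b \<otimes>\<^bsub>C,H \<Otimes> H\<^esub> (g \<otimes>\<^bsub>H,H\<^esub> h))"
        by (subst tsum_tparts[OF C is_vspace_tprod trilin_bilin3[OF trilin_tens_right] coact_mem[OF a]]) simp_all
      also have "\<dots> = (\<Sum>(b, g)\<leftarrow>\<delta>parts a. \<Phi> (b \<otimes>\<^bsub>C,H \<Otimes> H\<^esub> (g \<otimes>\<^bsub>H,H\<^esub> h)))"
        by (rule lin_sum_list[OF is_vspace_tprod \<Phi>]) (auto intro!: tens_in_tprod coparts_mem[OF a])
      also have "\<dots> = (\<Sum>(b, g)\<leftarrow>\<delta>parts a. F b g h)"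
        by (rule sum_list_pair_cong)
          (simp add: \<Phi>_tens tens_in_tprod coparts_mem[OF a] tsum_tens[OF Y trilin_bilin1[OF F]])
      finally show ?thesis .
    qed
    then show ?thesis
      unfolding lin_tparts[OF C L coact_mem[OF c]] by (intro sum_list_pair_cong) (use coparts_mem[OF c] in blast)
  qed
  have r: "\<Phi> (tmap C H C (H \<Otimes> H) id \<Delta> (\<delta> c)) =
      (\<Sum>(a, h)\<leftarrow>\<delta>parts c. \<Sum>(h1, h2)\<leftarrow>\<Delta>parts h. F a h1 h2)" (is "?R (\<delta> c) = _")
  proof -
    have R: "lin (C \<Otimes> H) Y ?R"
      by (rule lin_comp[OF lin_tmap[OF C lin_id comult_linear] \<Phi>])
    have "?R (a \<otimes>\<^bsub>C,H\<^esub> h) = (\<Sum>(h1, h2)\<leftarrow>\<Delta>parts h. F a h1 h2)" if a: "a \<in> carr C" for a h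
      by (subst tmap_tens[OF lin_id comult_linear a H_mem])
        (simp only: id_apply \<Phi>_tens[OF a comult_mem] tsum_tparts[OF H Y trilin_bilin1[OF F a] comult_mem])
    then show ?thesis
      unfolding lin_tparts[OF C R coact_mem[OF c]] by (intro sum_list_pair_cong) (use coparts_mem[OF c] in blast)
  qed
  show ?thesis
    using l r coact_coassoc[OF c] by simp
qed

end

locale H_module = bialgebra sH \<Delta> \<epsilon>
  for sH :: "'k::field \<Rightarrow> 'h::ring_1 \<Rightarrow> 'h" and \<Delta> and \<epsilon> +
  fixes X :: "('k, 'x::ab_group_add) vspace" and act :: "'h \<Rightarrow> 'x \<Rightarrow> 'x"
  assumes X: "is_vspace X"
    and act_bilin: "bilin (full sH) X X act"
    and act_unit: "x \<in> carr X \<Longrightarrow> act 1 x = x"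
    and act_mult: "x \<in> carr X \<Longrightarrow> act (a * b) x = act a (act b x)"
begin

lemma act_mem: "x \<in> carr X \<Longrightarrow> act h x \<in> carr X"
  by (rule bilin_mem[OF act_bilin]) simp

end


section \<open>The braiding of a comodule with a module\<close>

text \<open>The map \<open>c \<otimes> x \<mapsto> c\<^sub>1 x \<otimes> c\<^sub>0\<close>, of which \<open>\<sigma>\<^sub>H\<^sub>,\<^sub>M\<close>, \<open>\<sigma>\<^sub>H\<^sub>,\<^sub>D\<close> and \<open>\<sigma>\<^sub>M\<^sub>,\<^sub>D\<close> are instances.\<close>

definition braid where
  "braid sH C \<delta> X act T =
    tsum C X T (\<lambda>c x. tsum C (full sH) (\<delta> c) (\<lambda>a h. act h x \<otimes>\<^bsub>X,C\<^esub> a))"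

locale comodule_with_module = H_comodule sH \<Delta> \<epsilon> C \<delta> + H_module sH \<Delta> \<epsilon> X act
  for sH :: "'k::field \<Rightarrow> 'h::ring_1 \<Rightarrow> 'h" and \<Delta> and \<epsilon>
    and C :: "('k, 'c::ab_group_add) vspace" and \<delta>
    and X :: "('k, 'x::ab_group_add) vspace" and act
begin

abbreviation "\<sigma> \<equiv> braid sH C \<delta> X act"

lemma trilin_braid: "trilin C H X (X \<Otimes> C) (\<lambda>a h x. act h x \<otimes>\<^bsub>X,C\<^esub> a)"
  by (intro trilinI bilin_post[OF lin_tens_left act_bilin] lin_tens_right act_mem)

lemma bilin_braid: "bilin C X (X \<Otimes> C) (\<lambda>c x. tsum C H (\<delta> c) (\<lambda>a h. act h x \<otimes>\<^bsub>X,C\<^esub> a))"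
  by (rule bilin_pre[OF coact_lin lin_id bilin_tsum_left[OF C X is_vspace_tprod trilin_braid], unfolded id_def])

lemma lin_braid: "lin (C \<Otimes> X) (X \<Otimes> C) \<sigma>"
  unfolding braid_def by (rule lin_tsum[OF C is_vspace_tprod bilin_braid])

lemma braid_tens_tsum:
  "c \<in> carr C \<Longrightarrow> x \<in> carr X \<Longrightarrow> \<sigma> (c \<otimes>\<^bsub>C,X\<^esub> x) = tsum C H (\<delta> c) (\<lambda>a h. act h x \<otimes>\<^bsub>X,C\<^esub> a)"
  unfolding braid_def by (rule tsum_tens[OF is_vspace_tprod bilin_braid])

lemma braid_tens:
  assumes c: "c \<in> carr C" and x: "x \<in> carr X"
  shows "\<sigma> (c \<otimes>\<^bsub>C,X\<^esub> x) = (\<Sum>(a, h)\<leftarrow>\<delta>parts c. act h x \<otimes>\<^bsub>X,C\<^esub> a)"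
  unfolding braid_tens_tsum[OF c x]
  by (rule tsum_tparts[OF C is_vspace_tprod trilin_bilin3[OF trilin_braid x] coact_mem[OF c]])

lemma on_left_braid:
  assumes W: "is_vspace W" and c: "c \<in> carr C" and x: "x \<in> carr X" and w: "w \<in> carr W"
  shows "on_left C X W \<sigma> ((c \<otimes>\<^bsub>C,X\<^esub> x) \<otimes>\<^bsub>C \<Otimes> X,W\<^esub> w) =
    (\<Sum>(a, h)\<leftarrow>\<delta>parts c. (act h x \<otimes>\<^bsub>X,C\<^esub> a) \<otimes>\<^bsub>X \<Otimes> C,W\<^esub> w)"
  by (rule on_left_sum[OF C X W lin_braid c x w _ braid_tens[OF c x]])
    (use act_mem[OF x] coparts_mem[OF c] in blast)

lemma on_right_braid:
  assumes U: "is_vspace U" and u: "u \<in> carr U" and c: "c \<in> carr C" and x: "x \<in> carr X"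
  shows "on_right U C X \<sigma> ((u \<otimes>\<^bsub>U,C\<^esub> c) \<otimes>\<^bsub>U \<Otimes> C,X\<^esub> x) =
    (\<Sum>(a, h)\<leftarrow>\<delta>parts c. (u \<otimes>\<^bsub>U,X\<^esub> act h x) \<otimes>\<^bsub>U \<Otimes> X,C\<^esub> a)"
  by (rule on_right_sum[OF U C X lin_braid u c x _ braid_tens[OF c x]])
    (use act_mem[OF x] coparts_mem[OF c] in blast)

end

section \<open>The mixed Yang-Baxter equations\<close>

text \<open>
  Going one way, \<open>a\<close> and \<open>b\<close> are multiplied first and \<open>ab\<close> then passes \<open>x\<close>; going the other way,
  \<open>b\<close> and \<open>a\<close> pass \<open>x\<close> one after the other and what is left of them is multiplied. Multiplicativity
  of \<open>\<Delta>\<close> makes the results agree. The unit that is created passes \<open>x\<close> unchanged since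
  \<open>\<Delta> 1 = 1 \<otimes> 1\<close>.
\<close>

lemma (in H_module) yang_baxter_fuse_braid:
  "colored_yang_baxter H H X (unital_algebra.fuse_left H (*) 1) (braid sH H \<Delta> X act) (braid sH H \<Delta> X act)"
proof -
  interpret A: unital_algebra H "(*)" 1 by (rule H_algebra)
  interpret HX: comodule_with_module sH \<Delta> \<epsilon> H \<Delta> X act
    by (intro comodule_with_module.intro H_comodule_H H_module_axioms)
  let ?\<sigma> = "braid sH H \<Delta> X act"
  have \<sigma>_one: "?\<sigma> (1 \<otimes>\<^bsub>H,X\<^esub> x) = x \<otimes>\<^bsub>X,H\<^esub> 1" if x: "x \<in> carr X" for x
    by (simp add: HX.braid_tens_tsum[OF H_mem x] comult_one act_unit[OF x]
        tsum_tens[OF is_vspace_tprod trilin_bilin3[OF HX.trilin_braid x]])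
  show ?thesis
  proof (rule colored_yang_baxterI[OF H H X A.lin_fuse_left HX.lin_braid HX.lin_braid])
    fix a b x assume x: "x \<in> carr X"
    have t: "p \<otimes>\<^bsub>X,H\<^esub> q \<in> carr (X \<Otimes> H)" if "p \<in> carr X" for p q
      using that by (simp add: tens_in_tprod)
    let ?R = "\<Sum>(a1, a2)\<leftarrow>\<Delta>parts a. \<Sum>(b1, b2)\<leftarrow>\<Delta>parts b.
      (act (a2 * b2) x \<otimes>\<^bsub>X,H\<^esub> (a1 * b1)) \<otimes>\<^bsub>X \<Otimes> H,H\<^esub> 1"
    have "on_left H X H ?\<sigma> (on_right H H X ?\<sigma> (on_left H H X A.fuse_left ((a \<otimes>\<^bsub>H,H\<^esub> b) \<otimes>\<^bsub>H \<Otimes> H,X\<^esub> x))) =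
        on_left H X H ?\<sigma> (((a * b) \<otimes>\<^bsub>H,X\<^esub> x) \<otimes>\<^bsub>H \<Otimes> X,H\<^esub> 1)"
      by (simp add: on_left_tens[OF H H X A.lin_fuse_left _ _ x] A.fuse_left_tens
          on_right_pure[OF H H X HX.lin_braid _ _ x x _ \<sigma>_one[OF x]])
    also have "\<dots> = ?\<sigma> ((a * b) \<otimes>\<^bsub>H,X\<^esub> x) \<otimes>\<^bsub>X \<Otimes> H,H\<^esub> 1"
      by (rule on_left_tens[OF H X H HX.lin_braid _ x]) simp_all
    also have "?\<sigma> ((a * b) \<otimes>\<^bsub>H,X\<^esub> x) =
        (\<Sum>(a1, a2)\<leftarrow>\<Delta>parts a. \<Sum>(b1, b2)\<leftarrow>\<Delta>parts b. act (a2 * b2) x \<otimes>\<^bsub>X,H\<^esub> (a1 * b1))"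
      unfolding HX.braid_tens_tsum[OF H_mem x]
      by (rule comult_mult_sum[OF is_vspace_tprod trilin_bilin3[OF HX.trilin_braid x]])
    also have "\<dots> \<otimes>\<^bsub>X \<Otimes> H,H\<^esub> 1 = ?R"
      by (rule lin_sum_list2[OF is_vspace_tprod lin_tens_left[OF H_mem]]) (intro t act_mem x)
    finally have lhs: "on_left H X H ?\<sigma> (on_right H H X ?\<sigma>
        (on_left H H X A.fuse_left ((a \<otimes>\<^bsub>H,H\<^esub> b) \<otimes>\<^bsub>H \<Otimes> H,X\<^esub> x))) = ?R" .
    have "on_right X H H A.fuse_left (on_left H X H ?\<sigma> (on_right H H X ?\<sigma> ((a \<otimes>\<^bsub>H,H\<^esub> b) \<otimes>\<^bsub>H \<Otimes> H,X\<^esub> x))) =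
        on_right X H H A.fuse_left (on_left H X H ?\<sigma>
          (\<Sum>(b1, b2)\<leftarrow>\<Delta>parts b. (a \<otimes>\<^bsub>H,X\<^esub> act b2 x) \<otimes>\<^bsub>H \<Otimes> X,H\<^esub> b1))"
      by (simp add: HX.on_right_braid[OF H _ _ x])
    also have "\<dots> = on_right X H H A.fuse_left
          (\<Sum>(b1, b2)\<leftarrow>\<Delta>parts b. on_left H X H ?\<sigma> ((a \<otimes>\<^bsub>H,X\<^esub> act b2 x) \<otimes>\<^bsub>H \<Otimes> X,H\<^esub> b1))"
      by (rule arg_cong[OF lin_sum_list[OF is_vspace_tprod lin_on_left[OF H X H HX.lin_braid]]])
        (intro tens_in_tprod act_mem x H_mem)
    also have "\<dots> = on_right X H H A.fuse_left
          (\<Sum>(b1, b2)\<leftarrow>\<Delta>parts b. \<Sum>(a1, a2)\<leftarrow>\<Delta>parts a. (act a2 (act b2 x) \<otimes>\<^bsub>X,H\<^esub> a1) \<otimes>\<^bsub>X \<Otimes> H,H\<^esub> b1)"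
      by (simp add: HX.on_left_braid[OF H _ act_mem[OF x]])
    also have "\<dots> = (\<Sum>(b1, b2)\<leftarrow>\<Delta>parts b. \<Sum>(a1, a2)\<leftarrow>\<Delta>parts a.
        on_right X H H A.fuse_left ((act a2 (act b2 x) \<otimes>\<^bsub>X,H\<^esub> a1) \<otimes>\<^bsub>X \<Otimes> H,H\<^esub> b1))"
      by (rule lin_sum_list2[OF is_vspace_tprod lin_on_right[OF X H H A.lin_fuse_left]])
        (intro tens_in_tprod act_mem x H_mem)
    also have "\<dots> = (\<Sum>(b1, b2)\<leftarrow>\<Delta>parts b. \<Sum>(a1, a2)\<leftarrow>\<Delta>parts a.
        (act (a2 * b2) x \<otimes>\<^bsub>X,H\<^esub> (a1 * b1)) \<otimes>\<^bsub>X \<Otimes> H,H\<^esub> 1)"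
      by (simp add: on_right_pure[OF X H H A.lin_fuse_left _ _ _ _ _ A.fuse_left_tens] act_mem x act_mult)
    also have "\<dots> = ?R" by (rule sum_list_pair_swap)
    finally show "on_left H X H ?\<sigma> (on_right H H X ?\<sigma>
        (on_left H H X A.fuse_left ((a \<otimes>\<^bsub>H,H\<^esub> b) \<otimes>\<^bsub>H \<Otimes> H,X\<^esub> x))) =
      on_right X H H A.fuse_left (on_left H X H ?\<sigma>
        (on_right H H X ?\<sigma> ((a \<otimes>\<^bsub>H,H\<^esub> b) \<otimes>\<^bsub>H \<Otimes> H,X\<^esub> x)))"
      using lhs by simp
  qed
qed

text \<open>
  The two factors of \<open>h (ab) = (h\<^sub>2 a)(h\<^sub>1 b)\<close> receive the legs of \<open>\<Delta> h\<close> in reversed order, so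
  \<open>A\<close> is a module algebra in the usual sense over the co-opposite bialgebra. This matches the
  convention for the product of \<open>H\<^sup>*\<close>.
\<close>

locale module_algebra = H_module sH \<Delta> \<epsilon> A act + unital_algebra A mult unit
  for sH :: "'k::field \<Rightarrow> 'h::ring_1 \<Rightarrow> 'h" and \<Delta> and \<epsilon>
    and A :: "('k, 'a::ab_group_add) vspace" and act and mult and unit +
  assumes act_on_unit: "act h unit = scl A (\<epsilon> h) unit"
    and act_on_mult: "a \<in> carr A \<Longrightarrow> b \<in> carr A \<Longrightarrow>
      act h (mult a b) = (\<Sum>(h1, h2)\<leftarrow>tparts (full sH) (full sH) (\<Delta> h). mult (act h2 a) (act h1 b))"

locale comodule_with_module_algebra =
  comodule_with_module sH \<Delta> \<epsilon> C \<delta> A act + module_algebra sH \<Delta> \<epsilon> A act mult unit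
  for sH :: "'k::field \<Rightarrow> 'h::ring_1 \<Rightarrow> 'h" and \<Delta> and \<epsilon>
    and C :: "('k, 'c::ab_group_add) vspace" and \<delta>
    and A :: "('k, 'a::ab_group_add) vspace" and act and mult and unit
begin

text \<open>The counit axiom of the coaction lets the unit of \<open>A\<close> pass any \<open>c\<close> unchanged.\<close>

lemma braid_unit:
  assumes c: "c \<in> carr C"
  shows "\<sigma> (c \<otimes>\<^bsub>C,A\<^esub> unit) = unit \<otimes>\<^bsub>A,C\<^esub> c"
proof -
  have eq: "scl A k unit \<otimes>\<^bsub>A,C\<^esub> a = unit \<otimes>\<^bsub>A,C\<^esub> scl C k a" if "a \<in> carr C" for k a
    using bilin_tens[of A C] unit_mem that by (simp add: bilin_iff)
  have b: "bilin C H C (\<lambda>a h. scl C (\<epsilon> h) a)"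
  proof -
    interpret C: vector_space "scl C" using C by (simp add: is_vspace_def)
    show ?thesis using C counit_linear
      by (simp add: bilin_iff is_vspaceD lin_def C.scale_left_distrib full_def mult.commute)
  qed
  have "\<sigma> (c \<otimes>\<^bsub>C,A\<^esub> unit) = (\<Sum>(a, h)\<leftarrow>\<delta>parts c. unit \<otimes>\<^bsub>A,C\<^esub> scl C (\<epsilon> h) a)"
    unfolding braid_tens[OF c unit_mem]
    by (rule sum_list_pair_cong) (simp add: act_on_unit eq coparts_mem[OF c])
  also have "\<dots> = unit \<otimes>\<^bsub>A,C\<^esub> (\<Sum>(a, h)\<leftarrow>\<delta>parts c. scl C (\<epsilon> h) a)"
    by (rule lin_sum_list[OF C lin_tens_right[OF unit_mem], symmetric])
      (auto intro: is_vspaceD(3)[OF C] coparts_mem[OF c])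
  also have "(\<Sum>(a, h)\<leftarrow>\<delta>parts c. scl C (\<epsilon> h) a) = c"
    using coact_counit[OF c] tsum_tparts[OF C C b coact_mem[OF c]] by simp
  finally show ?thesis .
qed

text \<open>
  One way, \<open>c\<close> passes \<open>l\<close> and \<open>k\<close> in turn, which gives \<open>(c\<^sub>1 l)(c\<^sub>0\<^sub>1 k)\<close>. The other way, \<open>c\<close> passes
  the unit and then \<open>lk\<close>, which gives \<open>c\<^sub>1(lk) = (c\<^sub>1\<^sub>2 l)(c\<^sub>1\<^sub>1 k)\<close>. Coassociativity identifies them.
\<close>

lemma yang_baxter_braid_fuse: "colored_yang_baxter C A A \<sigma> \<sigma> fuse_right"
proof (rule colored_yang_baxterI[OF C A A lin_braid lin_braid lin_fuse_right])
  fix c l k assume c: "c \<in> carr C" and l: "l \<in> carr A" and k: "k \<in> carr A"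
  let ?F = "\<lambda>b g h. (unit \<otimes>\<^bsub>A,A\<^esub> mult (act h l) (act g k)) \<otimes>\<^bsub>A \<Otimes> A,C\<^esub> b"
  have mem: "a \<in> carr C" "b \<in> carr C" if "(a, h) \<in> set (\<delta>parts c)" "(b, g) \<in> set (\<delta>parts a)" for a h b g
    using that coparts_mem c by blast+
  have F: "trilin C H H ((A \<Otimes> A) \<Otimes> C) ?F"
    by (intro trilinI bilin_post[OF lin_tens_left] bilin_post[OF lin_tens_right[OF unit_mem]]
        bilin_flip[OF bilin_pre[OF bilin_lin_left[OF act_bilin l] bilin_lin_left[OF act_bilin k] mult_bilin]]
        lin_tens_right tens_in_tprod unit_mem mult_mem act_mem l k)
  have "on_left A A C fuse_right (on_right A C A \<sigma> (on_left C A A \<sigma> ((c \<otimes>\<^bsub>C,A\<^esub> l) \<otimes>\<^bsub>C \<Otimes> A,A\<^esub> k))) =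
      on_left A A C fuse_right (on_right A C A \<sigma>
        (\<Sum>(a, h)\<leftarrow>\<delta>parts c. (act h l \<otimes>\<^bsub>A,C\<^esub> a) \<otimes>\<^bsub>A \<Otimes> C,A\<^esub> k))"
    by (simp only: on_left_braid[OF A c l k])
  also have "\<dots> = on_left A A C fuse_right
      (\<Sum>(a, h)\<leftarrow>\<delta>parts c. on_right A C A \<sigma> ((act h l \<otimes>\<^bsub>A,C\<^esub> a) \<otimes>\<^bsub>A \<Otimes> C,A\<^esub> k))"
    by (rule arg_cong[OF lin_sum_list[OF is_vspace_tprod lin_on_right[OF A C A lin_braid]]])
      (intro tens_in_tprod act_mem l k coparts_mem[OF c])
  also have "\<dots> = on_left A A C fuse_right
      (\<Sum>(a, h)\<leftarrow>\<delta>parts c. \<Sum>(b, g)\<leftarrow>\<delta>parts a. (act h l \<otimes>\<^bsub>A,A\<^esub> act g k) \<otimes>\<^bsub>A \<Otimes> A,C\<^esub> b)"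
    by (intro arg_cong[where f = "on_left A A C fuse_right"] sum_list_pair_cong)
      (rule on_right_braid[OF A act_mem[OF l] coparts_mem[OF c] k])
  also have "\<dots> = (\<Sum>(a, h)\<leftarrow>\<delta>parts c. \<Sum>(b, g)\<leftarrow>\<delta>parts a.
      on_left A A C fuse_right ((act h l \<otimes>\<^bsub>A,A\<^esub> act g k) \<otimes>\<^bsub>A \<Otimes> A,C\<^esub> b))"
    by (rule lin_sum_list2[OF is_vspace_tprod lin_on_left[OF A A C lin_fuse_right]])
      (intro tens_in_tprod act_mem l k mem(2))
  also have "\<dots> = (\<Sum>(a, h)\<leftarrow>\<delta>parts c. \<Sum>(b, g)\<leftarrow>\<delta>parts a. ?F b g h)"
    by (intro sum_list_pair_cong)
      (simp add: on_left_tens[OF A A C lin_fuse_right] fuse_right_tens act_mem l k mem(2))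
  also have "\<dots> = (\<Sum>(a, h)\<leftarrow>\<delta>parts c. \<Sum>(h1, h2)\<leftarrow>\<Delta>parts h. ?F a h1 h2)"
    by (rule coassoc_sum[OF is_vspace_tprod F c])
  finally have lhs: "on_left A A C fuse_right (on_right A C A \<sigma>
      (on_left C A A \<sigma> ((c \<otimes>\<^bsub>C,A\<^esub> l) \<otimes>\<^bsub>C \<Otimes> A,A\<^esub> k))) =
      (\<Sum>(a, h)\<leftarrow>\<delta>parts c. \<Sum>(h1, h2)\<leftarrow>\<Delta>parts h. ?F a h1 h2)" .
  have "on_right A C A \<sigma> (on_left C A A \<sigma> (on_right C A A fuse_right ((c \<otimes>\<^bsub>C,A\<^esub> l) \<otimes>\<^bsub>C \<Otimes> A,A\<^esub> k))) =
      on_right A C A \<sigma> ((unit \<otimes>\<^bsub>A,C\<^esub> c) \<otimes>\<^bsub>A \<Otimes> C,A\<^esub> mult l k)"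
    by (simp add: on_right_pure[OF C A A lin_fuse_right c l k unit_mem mult_mem[OF l k] fuse_right_tens[OF l k]]
        on_left_tens[OF C A A lin_braid c unit_mem mult_mem[OF l k]] braid_unit[OF c])
  also have "\<dots> = (\<Sum>(a, h)\<leftarrow>\<delta>parts c. (unit \<otimes>\<^bsub>A,A\<^esub> act h (mult l k)) \<otimes>\<^bsub>A \<Otimes> A,C\<^esub> a)"
    by (rule on_right_braid[OF A unit_mem c mult_mem[OF l k]])
  also have "\<dots> = (\<Sum>(a, h)\<leftarrow>\<delta>parts c. \<Sum>(h1, h2)\<leftarrow>\<Delta>parts h. ?F a h1 h2)"
    unfolding act_on_mult[OF l k]
    by (rule sum_list_pair_cong,
        rule lin_sum_list[OF A lin_comp[OF lin_tens_right[OF unit_mem] lin_tens_left[OF coparts_mem[OF c]]]],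
        assumption, intro mult_mem act_mem l k)
  finally show "on_left A A C fuse_right (on_right A C A \<sigma> (on_left C A A \<sigma> ((c \<otimes>\<^bsub>C,A\<^esub> l) \<otimes>\<^bsub>C \<Otimes> A,A\<^esub> k))) =
      on_right A C A \<sigma> (on_left C A A \<sigma> (on_right C A A fuse_right ((c \<otimes>\<^bsub>C,A\<^esub> l) \<otimes>\<^bsub>C \<Otimes> A,A\<^esub> k)))"
    using lhs by simp
qed

end

context yetter_drinfeld_module
begin

abbreviation "M \<equiv> full sM"

lemma M: "is_vspace M"
  by (rule is_vspace_full) unfold_locales

lemma M_mem [simp]: "m \<in> carr M"
  by (simp add: full_def)

lemma H_comodule_M: "H_comodule sH \<Delta> \<epsilon> M \<delta>"
proof
  show "tsum M H (\<delta> m) (\<lambda>a h. scl M (\<epsilon> h) a) = m" for m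
    using coact_counit[of m] by (simp add: full_def)
qed (rule M coact_linear coact_coassoc)+

lemma H_module_M: "H_module sH \<Delta> \<epsilon> M act"
  by standard (rule M act_bilinear act_one act_mult)+

text \<open>The Yetter-Drinfel'd condition with a bilinear \<open>G\<close> applied to the two legs in \<open>M \<otimes> H\<close>.\<close>

lemma yetter_drinfeld_sum:
  assumes Y: "is_vspace Y" and G: "bilin M H Y G"
  shows "(\<Sum>(h1, h2)\<leftarrow>\<Delta>parts h. tsum M H (\<delta> (act h2 m)) (\<lambda>n0 n1. G n0 (n1 * h1))) =
    (\<Sum>(h1, h2)\<leftarrow>\<Delta>parts h. tsum M H (\<delta> m) (\<lambda>m0 m1. G (act h1 m0) (h2 * m1)))"
proof -
  define \<Phi> where "\<Phi> T = tsum M H T G" for T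
  have \<Phi>: "lin (M \<Otimes> H) Y \<Phi>"
    unfolding \<Phi>_def by (rule lin_tsum[OF M Y G])
  have \<Phi>_tens: "\<Phi> (n \<otimes>\<^bsub>M,H\<^esub> k) = G n k" for n k
    unfolding \<Phi>_def by (rule tsum_tens[OF Y G]) simp_all
  have \<delta>_mem: "\<delta> m \<in> carr (M \<Otimes> H)" for m
    by (rule lin_mem[OF coact_linear]) simp
  have push: "\<Phi> (tsum H H (\<Delta> h) f) = (\<Sum>(h1, h2)\<leftarrow>\<Delta>parts h. \<Phi> (f h1 h2))"
    if f: "bilin H H (M \<Otimes> H) f" for f
    unfolding tsum_tparts[OF H is_vspace_tprod f comult_mem]
    by (rule lin_sum_list[OF is_vspace_tprod \<Phi>]) (rule bilin_mem[OF f H_mem H_mem])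
  let ?l = "\<lambda>h1 h2. tsum M H (\<delta> (act h2 m)) (\<lambda>n0 n1. n0 \<otimes>\<^bsub>M,H\<^esub> (n1 * h1))"
  let ?r = "\<lambda>h1 h2. tsum M H (\<delta> m) (\<lambda>m0 m1. act h1 m0 \<otimes>\<^bsub>M,H\<^esub> (h2 * m1))"
  have mult: "lin H H (\<lambda>x. x * h)" "lin H H (\<lambda>x. h * x)" for h
    by (rule lin_mult_right, rule bilin_lin_right[OF bilin_mult]) simp
  have act: "lin M M (act h)" "lin H M (\<lambda>h. act h m)" for h m
    using bilin_lin_right[OF act_bilinear] bilin_lin_left[OF act_bilinear] by simp_all
  have l3: "trilin M H H (M \<Otimes> H) (\<lambda>n0 n1 h1. n0 \<otimes>\<^bsub>M,H\<^esub> (n1 * h1))"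
    by (intro trilinI bilin_post[OF lin_tens_right bilin_mult] lin_tens_left) simp_all
  have l2: "bilin M H (M \<Otimes> H) (\<lambda>n0 n1. n0 \<otimes>\<^bsub>M,H\<^esub> (n1 * h1))" for h1
    by (rule trilin_bilin3[OF l3]) simp
  have l: "bilin H H (M \<Otimes> H) ?l"
    by (rule bilin_flip[OF bilin_pre[OF lin_comp[OF act(2) coact_linear] lin_id
            bilin_tsum_left[OF M H is_vspace_tprod l3], unfolded id_def]])
  have r2: "bilin M H (M \<Otimes> H) (\<lambda>m0 m1. act h1 m0 \<otimes>\<^bsub>M,H\<^esub> (h2 * m1))" for h1 h2
    by (rule bilin_pre[OF act(1) mult(2) bilin_tens])
  have r: "bilin H H (M \<Otimes> H) ?r"
    by (rule bilin_tsum_param[OF H H M is_vspace_tprod \<delta>_mem r2 bilin_pre[OF act(2) mult(1) bilin_tens]])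
  have "(\<Sum>(h1, h2)\<leftarrow>\<Delta>parts h. \<Phi> (?l h1 h2)) = (\<Sum>(h1, h2)\<leftarrow>\<Delta>parts h. \<Phi> (?r h1 h2))"
    using arg_cong[OF yetter_drinfeld[of h m], of \<Phi>] unfolding push[OF l] push[OF r] .
  then show ?thesis
    by (simp only: lin_tsum_push[OF M is_vspace_tprod Y \<Phi> l2 \<delta>_mem]
        lin_tsum_push[OF M is_vspace_tprod Y \<Phi> r2 \<delta>_mem] \<Phi>_tens)
qed

end

locale yetter_drinfeld_with_module =
  yetter_drinfeld_module sH \<Delta> \<epsilon> sM actM \<delta> + H_module sH \<Delta> \<epsilon> X act
  for sH :: "'k::field \<Rightarrow> 'h::ring_1 \<Rightarrow> 'h" and \<Delta> and \<epsilon>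
    and sM :: "'k \<Rightarrow> 'm::ab_group_add \<Rightarrow> 'm" and actM and \<delta>
    and X :: "('k, 'x::ab_group_add) vspace" and act
begin

sublocale HM: comodule_with_module sH \<Delta> \<epsilon> H \<Delta> M actM
  by (intro comodule_with_module.intro H_comodule_H H_module_M)

sublocale HX: comodule_with_module sH \<Delta> \<epsilon> H \<Delta> X act
  by (intro comodule_with_module.intro H_comodule_H H_module_axioms)

sublocale MX: comodule_with_module sH \<Delta> \<epsilon> M \<delta> X act
  by (intro comodule_with_module.intro H_comodule_M H_module_axioms)

text \<open>
  After coassociativity, both sides have the form \<open>k x \<otimes> n \<otimes> h\<^sub>1\<close>, where \<open>n \<otimes> k\<close> is
  \<open>(h\<^sub>3 m)\<^sub>0 \<otimes> (h\<^sub>3 m)\<^sub>1 h\<^sub>2\<close> on the left and \<open>h\<^sub>2 m\<^sub>0 \<otimes> h\<^sub>3 m\<^sub>1\<close> on the right. These are the two sides of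
  the Yetter-Drinfel'd condition. Below, \<open>G b n k = k x \<otimes> n \<otimes> b\<close>, and \<open>F\<close> is the trilinear map to
  which coassociativity is applied on the left.
\<close>

lemma yang_baxter_yetter_drinfeld: "colored_yang_baxter H M X HM.\<sigma> HX.\<sigma> MX.\<sigma>"
proof (rule colored_yang_baxterI[OF H M X HM.lin_braid HX.lin_braid MX.lin_braid])
  fix h m x assume x: "x \<in> carr X"
  let ?Y = "(X \<Otimes> M) \<Otimes> H"
  note Y = is_vspace_tprod[of "X \<Otimes> M" H]
  have actX: "lin H X (\<lambda>g. act g y)" if "y \<in> carr X" for y
    by (rule bilin_lin_left[OF act_bilin that])
  have actM: "lin H M (\<lambda>h. actM h m)" for m
    by (rule bilin_lin_left[OF act_bilinear M_mem])
  define G where "G b n k = (act k x \<otimes>\<^bsub>X,M\<^esub> n) \<otimes>\<^bsub>X \<Otimes> M,H\<^esub> b" for b n k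
  have G3: "trilin H M H ?Y G"
    unfolding G_def
    by (intro trilinI bilin_post[OF lin_tens_left] bilin_flip[OF bilin_pre[OF actX lin_id bilin_tens, unfolded id_def]]
        lin_tens_right tens_in_tprod act_mem x H_mem M_mem)
  have G: "bilin M H ?Y (G b)" for b
    by (rule trilin_bilin1[OF G3 H_mem])
  have Gg: "trilin M H H ?Y (\<lambda>n0 n1 g. G b n0 (n1 * g))" for b
    by (intro trilinI bilin_post[OF bilin_lin_right[OF G]] bilin_mult bilin_lin_left[OF G] H_mem)
  have Gb: "trilin M H H ?Y (\<lambda>n0 n1 b. G b n0 (n1 * g))" for g
    by (intro trilinI bilin_flip[OF bilin_pre[OF lin_id lin_mult_right trilin_bilin2[OF G3], unfolded id_def]]
        bilin_lin_left[OF G] H_mem)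
  define F where "F b g h = tsum M H (\<delta> (actM h m)) (\<lambda>n0 n1. G b n0 (n1 * g))" for b g h
  have \<delta>_act: "lin H (M \<Otimes> H) (\<lambda>h. \<delta> (actM h m))"
    by (rule lin_comp[OF actM coact_linear])
  have F: "trilin H H H ?Y F"
    unfolding F_def
  proof (rule trilinI)
    show "bilin H H ?Y (\<lambda>g h. tsum M H (\<delta> (actM h m)) (\<lambda>n0 n1. G b n0 (n1 * g)))" for b
      by (rule bilin_flip[OF bilin_pre[OF \<delta>_act lin_id bilin_tsum_left[OF M H Y Gg], unfolded id_def]])
    show "lin H ?Y (\<lambda>b. tsum M H (\<delta> (actM h m)) (\<lambda>n0 n1. G b n0 (n1 * g)))" for g h
      by (rule bilin_lin_right[OF bilin_tsum_left[OF M H Y Gb] lin_mem[OF \<delta>_act H_mem]])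
  qed
  have F_eq: "F b g h = (\<Sum>(n0, n1)\<leftarrow>MX.\<delta>parts (actM h m). (act n1 (act g x) \<otimes>\<^bsub>X,M\<^esub> n0) \<otimes>\<^bsub>X \<Otimes> M,H\<^esub> b)"
    for b g h
    unfolding F_def tsum_tparts[OF M Y trilin_bilin3[OF Gg H_mem] MX.coact_mem[OF M_mem]]
    by (simp add: G_def act_mult[OF x])
  have G': "bilin M H ?Y (\<lambda>m0 m1. G b (actM g m0) (h * m1))" for b g h
    by (intro bilin_pre[OF _ _ G] bilin_lin_right[OF act_bilinear] bilin_lin_right[OF bilin_mult] H_mem)
  have F': "trilin H H H ?Y (\<lambda>b g h. G b (actM g m0) (h * m1))" for m0 m1
    by (intro trilinI bilin_pre[OF actM lin_mult_right G] bilin_lin_left[OF trilin_bilin3[OF G3]] H_mem M_mem)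
  let ?R = "\<Sum>(a, h)\<leftarrow>\<Delta>parts h. \<Sum>(h1, h2)\<leftarrow>\<Delta>parts h. \<Sum>(m0, m1)\<leftarrow>MX.\<delta>parts m.
    (act (h2 * m1) x \<otimes>\<^bsub>X,M\<^esub> actM h1 m0) \<otimes>\<^bsub>X \<Otimes> M,H\<^esub> a"
  have "on_left M X H MX.\<sigma> (on_right M H X HX.\<sigma> (on_left H M X HM.\<sigma> ((h \<otimes>\<^bsub>H,M\<^esub> m) \<otimes>\<^bsub>H \<Otimes> M,X\<^esub> x))) =
      on_left M X H MX.\<sigma> (on_right M H X HX.\<sigma>
        (\<Sum>(a, h)\<leftarrow>\<Delta>parts h. (actM h m \<otimes>\<^bsub>M,H\<^esub> a) \<otimes>\<^bsub>M \<Otimes> H,X\<^esub> x))"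
    by (simp only: HM.on_left_braid[OF X H_mem M_mem x])
  also have "\<dots> = on_left M X H MX.\<sigma>
      (\<Sum>(a, h)\<leftarrow>\<Delta>parts h. on_right M H X HX.\<sigma> ((actM h m \<otimes>\<^bsub>M,H\<^esub> a) \<otimes>\<^bsub>M \<Otimes> H,X\<^esub> x))"
    by (rule arg_cong[OF lin_sum_list[OF is_vspace_tprod lin_on_right[OF M H X HX.lin_braid]]])
      (intro tens_in_tprod x H_mem M_mem)
  also have "\<dots> = on_left M X H MX.\<sigma>
      (\<Sum>(a, h)\<leftarrow>\<Delta>parts h. \<Sum>(b, g)\<leftarrow>\<Delta>parts a. (actM h m \<otimes>\<^bsub>M,X\<^esub> act g x) \<otimes>\<^bsub>M \<Otimes> X,H\<^esub> b)"
    by (simp only: HX.on_right_braid[OF M M_mem H_mem x])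
  also have "\<dots> = (\<Sum>(a, h)\<leftarrow>\<Delta>parts h. \<Sum>(b, g)\<leftarrow>\<Delta>parts a.
      on_left M X H MX.\<sigma> ((actM h m \<otimes>\<^bsub>M,X\<^esub> act g x) \<otimes>\<^bsub>M \<Otimes> X,H\<^esub> b))"
    by (rule lin_sum_list2[OF is_vspace_tprod lin_on_left[OF M X H MX.lin_braid]])
      (intro tens_in_tprod act_mem x H_mem M_mem)
  also have "\<dots> = (\<Sum>(a, h)\<leftarrow>\<Delta>parts h. \<Sum>(b, g)\<leftarrow>\<Delta>parts a. F b g h)"
    by (simp only: MX.on_left_braid[OF H M_mem act_mem[OF x] H_mem] F_eq)
  also have "\<dots> = (\<Sum>(a, h)\<leftarrow>\<Delta>parts h. \<Sum>(h1, h2)\<leftarrow>\<Delta>parts h. F a h1 h2)"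
    by (rule HM.coassoc_sum[OF Y F H_mem])
  also have "\<dots> = (\<Sum>(a, h)\<leftarrow>\<Delta>parts h. \<Sum>(h1, h2)\<leftarrow>\<Delta>parts h.
      tsum M H (\<delta> m) (\<lambda>m0 m1. G a (actM h1 m0) (h2 * m1)))"
    unfolding F_def by (simp only: yetter_drinfeld_sum[OF Y G])
  also have "\<dots> = ?R"
    by (simp only: tsum_tparts[OF M Y G' MX.coact_mem[OF M_mem]]) (simp only: G_def)
  finally have lhs: "on_left M X H MX.\<sigma> (on_right M H X HX.\<sigma>
      (on_left H M X HM.\<sigma> ((h \<otimes>\<^bsub>H,M\<^esub> m) \<otimes>\<^bsub>H \<Otimes> M,X\<^esub> x))) = ?R" .
  have "on_right X H M HM.\<sigma> (on_left H X M HX.\<sigma> (on_right H M X MX.\<sigma> ((h \<otimes>\<^bsub>H,M\<^esub> m) \<otimes>\<^bsub>H \<Otimes> M,X\<^esub> x))) =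
      on_right X H M HM.\<sigma> (on_left H X M HX.\<sigma>
        (\<Sum>(m0, m1)\<leftarrow>MX.\<delta>parts m. (h \<otimes>\<^bsub>H,X\<^esub> act m1 x) \<otimes>\<^bsub>H \<Otimes> X,M\<^esub> m0))"
    by (simp only: MX.on_right_braid[OF H H_mem M_mem x])
  also have "\<dots> = on_right X H M HM.\<sigma>
      (\<Sum>(m0, m1)\<leftarrow>MX.\<delta>parts m. on_left H X M HX.\<sigma> ((h \<otimes>\<^bsub>H,X\<^esub> act m1 x) \<otimes>\<^bsub>H \<Otimes> X,M\<^esub> m0))"
    by (rule arg_cong[OF lin_sum_list[OF is_vspace_tprod lin_on_left[OF H X M HX.lin_braid]]])
      (intro tens_in_tprod act_mem x H_mem M_mem)
  also have "\<dots> = on_right X H M HM.\<sigma>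
      (\<Sum>(m0, m1)\<leftarrow>MX.\<delta>parts m. \<Sum>(a, h)\<leftarrow>\<Delta>parts h. (act h (act m1 x) \<otimes>\<^bsub>X,H\<^esub> a) \<otimes>\<^bsub>X \<Otimes> H,M\<^esub> m0)"
    by (simp only: HX.on_left_braid[OF M H_mem act_mem[OF x] M_mem])
  also have "\<dots> = (\<Sum>(m0, m1)\<leftarrow>MX.\<delta>parts m. \<Sum>(a, h)\<leftarrow>\<Delta>parts h.
      on_right X H M HM.\<sigma> ((act h (act m1 x) \<otimes>\<^bsub>X,H\<^esub> a) \<otimes>\<^bsub>X \<Otimes> H,M\<^esub> m0))"
    by (rule lin_sum_list2[OF is_vspace_tprod lin_on_right[OF X H M HM.lin_braid]])
      (intro tens_in_tprod act_mem x H_mem M_mem)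
  also have "\<dots> = (\<Sum>(m0, m1)\<leftarrow>MX.\<delta>parts m. \<Sum>(a, h)\<leftarrow>\<Delta>parts h. \<Sum>(b, g)\<leftarrow>\<Delta>parts a. G b (actM g m0) (h * m1))"
    by (simp only: HM.on_right_braid[OF X act_mem[OF act_mem[OF x]] H_mem M_mem] G_def act_mult[OF x])
  also have "\<dots> = (\<Sum>(m0, m1)\<leftarrow>MX.\<delta>parts m. \<Sum>(a, h)\<leftarrow>\<Delta>parts h. \<Sum>(h1, h2)\<leftarrow>\<Delta>parts h. G a (actM h1 m0) (h2 * m1))"
    by (simp only: HM.coassoc_sum[OF Y F' H_mem])
  \<comment> \<open>the sum over \<open>\<delta> m\<close> moves inwards past both sums over \<open>H\<close>\<close>
  also have "\<dots> = ?R"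
    by (rule trans[OF sum_list_pair_swap], rule sum_list_pair_cong, rule trans[OF sum_list_pair_swap])
      (simp only: G_def)
  finally show "on_left M X H MX.\<sigma> (on_right M H X HX.\<sigma>
      (on_left H M X HM.\<sigma> ((h \<otimes>\<^bsub>H,M\<^esub> m) \<otimes>\<^bsub>H \<Otimes> M,X\<^esub> x))) =
    on_right X H M HM.\<sigma> (on_left H X M HX.\<sigma>
      (on_right H M X MX.\<sigma> ((h \<otimes>\<^bsub>H,M\<^esub> m) \<otimes>\<^bsub>H \<Otimes> M,X\<^esub> x)))"
    using lhs by simp
qed

end

section \<open>The dual algebra\<close>

definition dual_act :: "'h::ring_1 \<Rightarrow> ('h \<Rightarrow> 'k) \<Rightarrow> ('h \<Rightarrow> 'k)" where
  "dual_act h l = (\<lambda>x. l (x * h))"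

context bialgebra
begin

abbreviation "D \<equiv> dual sH"

lemma D: "is_vspace D"
  by (rule is_vspace_dual) unfold_locales

lemma is_vspace_scalars: "is_vspace (scalars :: ('k, 'k) vspace)"
  by (rule is_vspace_full) (standard, auto simp: algebra_simps)

lemma D_iff: "l \<in> carr D \<longleftrightarrow> (\<forall>x y. l (x + y) = l x + l y) \<and> (\<forall>c x. l (sH c x) = c * l x)"
  by (rule mem_dual) unfold_locales

lemma D_lin: "l \<in> carr D \<longleftrightarrow> lin H scalars l"
  by (simp add: D_iff lin_def full_def)

lemma scl_D [simp]: "scl D = fscale"
  by (simp add: dual_def)

lemma dual_act_bilin: "bilin H D D dual_act"
  by (auto simp: bilin_iff dual_act_def D_iff full_def fscale_def fun_eq_iff
      distrib_left distrib_right scale_mult_left[symmetric] scale_mult_right[symmetric])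

lemma H_module_D: "H_module sH \<Delta> \<epsilon> D dual_act"
  by standard (auto simp: D dual_act_bilin dual_act_def mult.assoc)

lemma bilin_convolution:
  assumes "l \<in> carr D" "k \<in> carr D"
  shows "bilin H H scalars (\<lambda>h1 h2. l h2 * k h1)"
  using assms by (auto simp: bilin_iff D_iff full_def algebra_simps)

lemma dual_mult_mem: "l \<in> carr D \<Longrightarrow> k \<in> carr D \<Longrightarrow> dual_mult sH \<Delta> l k \<in> carr D"
  unfolding D_lin dual_mult_def
  by (rule lin_comp[OF comult_linear lin_tsum[OF H is_vspace_scalars bilin_convolution]]) (simp_all add: D_lin)

lemma dual_mult_sum:
  assumes "l \<in> carr D" "k \<in> carr D"
  shows "dual_mult sH \<Delta> l k h = (\<Sum>(h1, h2)\<leftarrow>\<Delta>parts h. l h2 * k h1)"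
  unfolding dual_mult_def
  by (rule tsum_tparts[OF H is_vspace_scalars bilin_convolution[OF assms] comult_mem])

lemma dual_mult_bilin: "bilin D D D (dual_mult sH \<Delta>)"
  using is_vspaceD[OF D]
  by (auto simp: bilin_iff dual_mult_mem dual_mult_sum fun_eq_iff fscale_def case_prod_unfold distrib_left distrib_right
      sum_list_addf sum_list_const_mult[symmetric] mult.assoc mult.left_commute)

lemma counit_mem: "\<epsilon> \<in> carr D"
  using counit_linear by (simp add: D_lin)

text \<open>
  Both algebra laws of \<open>D\<close> are dual to laws of \<open>\<Delta>\<close>: associativity to coassociativity, the unit to
  the counit. The compatibility of product and action is multiplicativity of \<open>\<Delta>\<close>, evaluated at
  \<open>x h\<close>.
\<close>

lemma module_algebra_D: "module_algebra sH \<Delta> \<epsilon> D dual_act (dual_mult sH \<Delta>) \<epsilon>"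
proof -
  interpret HD: H_module sH \<Delta> \<epsilon> D dual_act by (rule H_module_D)
  interpret HH: H_comodule sH \<Delta> \<epsilon> H \<Delta> by (rule H_comodule_H)
  note S = is_vspace_scalars
  show ?thesis
  proof
    fix l assume l: "l \<in> carr D"
    have b: "bilin H H H (\<lambda>h1 h2. sH (\<epsilon> h1) h2)" "bilin H H H (\<lambda>h1 h2. sH (\<epsilon> h2) h1)"
      using counit_mem by (auto simp: bilin_iff D_iff full_def scale_left_distrib scale_right_distrib mult.commute)
    have scale: "l (sH c x) = c * l x" for c x
      using l by (simp add: D_iff)
    note push = lin_tsum_push[OF H H S l[unfolded D_lin] _ comult_mem, symmetric]
    show "dual_mult sH \<Delta> \<epsilon> l = l"
    proof
      fix h
      have "dual_mult sH \<Delta> \<epsilon> l h = tsum H H (\<Delta> h) (\<lambda>h1 h2. l (sH (\<epsilon> h2) h1))"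
        by (simp only: dual_mult_def scale)
      then show "dual_mult sH \<Delta> \<epsilon> l h = l h"
        by (simp only: push[OF b(2)] counit_right)
    qed
    show "dual_mult sH \<Delta> l \<epsilon> = l"
    proof
      fix h
      have "dual_mult sH \<Delta> l \<epsilon> h = tsum H H (\<Delta> h) (\<lambda>h1 h2. l (sH (\<epsilon> h1) h2))"
        by (simp only: dual_mult_def scale mult.commute[of "l _"])
      then show "dual_mult sH \<Delta> l \<epsilon> h = l h"
        by (simp only: push[OF b(1)] counit_left)
    qed
    fix k assume k: "k \<in> carr D"
    show "dual_act h (dual_mult sH \<Delta> l k) =
        (\<Sum>(h1, h2)\<leftarrow>\<Delta>parts h. dual_mult sH \<Delta> (dual_act h2 l) (dual_act h1 k))" for h
    proof
      fix x
      have "dual_act h (dual_mult sH \<Delta> l k) x =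
          (\<Sum>(x1, x2)\<leftarrow>\<Delta>parts x. \<Sum>(h1, h2)\<leftarrow>\<Delta>parts h. l (x2 * h2) * k (x1 * h1))"
        unfolding dual_act_def dual_mult_def by (rule comult_mult_sum[OF S bilin_convolution[OF l k]])
      also have "\<dots> = (\<Sum>(h1, h2)\<leftarrow>\<Delta>parts h. \<Sum>(x1, x2)\<leftarrow>\<Delta>parts x. l (x2 * h2) * k (x1 * h1))"
        by (rule sum_list_pair_swap)
      also have "\<dots> = (\<Sum>(h1, h2)\<leftarrow>\<Delta>parts h. dual_mult sH \<Delta> (dual_act h2 l) (dual_act h1 k) x)"
        by (simp add: dual_mult_sum HD.act_mem l k) (simp add: dual_act_def)
      finally show "dual_act h (dual_mult sH \<Delta> l k) x =
          (\<Sum>(h1, h2)\<leftarrow>\<Delta>parts h. dual_mult sH \<Delta> (dual_act h2 l) (dual_act h1 k)) x"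
        by (simp only: sum_list_fun_apply)
    qed
    fix n assume n: "n \<in> carr D"
    show "dual_mult sH \<Delta> (dual_mult sH \<Delta> l k) n = dual_mult sH \<Delta> l (dual_mult sH \<Delta> k n)"
    proof
      fix h
      have F: "trilin H H H scalars (\<lambda>b g h. l h * (k g * n b))"
        using l k n by (auto simp: trilin_def bilin_iff lin_def D_iff full_def algebra_simps)
      have "dual_mult sH \<Delta> (dual_mult sH \<Delta> l k) n h =
          (\<Sum>(a, h)\<leftarrow>\<Delta>parts h. \<Sum>(h1, h2)\<leftarrow>\<Delta>parts h. l h2 * (k h1 * n a))"
        by (simp add: dual_mult_sum dual_mult_mem l k n case_prod_unfold sum_list_mult_const[symmetric] mult.assoc)
      also have "\<dots> = (\<Sum>(a, h)\<leftarrow>\<Delta>parts h. \<Sum>(b, g)\<leftarrow>\<Delta>parts a. l h * (k g * n b))"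
        by (rule HH.coassoc_sum[OF S F H_mem, symmetric])
      also have "\<dots> = dual_mult sH \<Delta> l (dual_mult sH \<Delta> k n) h"
        by (simp add: dual_mult_sum dual_mult_mem l k n case_prod_unfold sum_list_const_mult[symmetric])
      finally show "dual_mult sH \<Delta> (dual_mult sH \<Delta> l k) n h = dual_mult sH \<Delta> l (dual_mult sH \<Delta> k n) h" .
    qed
  next
    show "dual_act h \<epsilon> = scl D (\<epsilon> h) \<epsilon>" for h
      by (simp add: dual_act_def fscale_def fun_eq_iff counit_mult mult.commute)
  qed (rule D dual_mult_bilin counit_mem)+
qed

text \<open>
  The bridge between the formulas with \<open>l\<^sub>1(h) l\<^sub>2\<close> and the action on \<open>D\<close>: evaluated at \<open>x\<close>,
  \<open>l\<^sub>1(h) l\<^sub>2(x) = l(x h)\<close>. Finite dimension is what makes \<open>dual_comult\<close> satisfy its defining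
  condition.
\<close>

lemma dual_comult_evaluation:
  assumes fd: "finite_dimensional_vector_space sH B" and l: "l \<in> carr D"
    and V: "is_vspace V" and v: "v \<in> carr V"
  shows "tsum D D (dual_comult sH l) (\<lambda>l1 l2. fscale (l1 h) l2 \<otimes>\<^bsub>D,V\<^esub> v) = dual_act h l \<otimes>\<^bsub>D,V\<^esub> v"
proof -
  let ?t = "dual_comult sH l"
  have t: "?t \<in> carr (D \<Otimes> D)" "l (h * h') = tsum D D ?t (\<lambda>l1 l2. l1 h' * l2 h)" for h h'
    using theI'[OF dual_comult_ex1[OF fd scale_mult_left scale_mult_right l]]
    unfolding dual_comult_def by blast+
  have b: "bilin D D D (\<lambda>l1 l2. fscale (l1 h) l2)"
    using is_vspaceD[OF D] by (auto simp: bilin_iff fscale_def fun_eq_iff algebra_simps)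
  have "tsum D D ?t (\<lambda>l1 l2. fscale (l1 h) l2) x = l (x * h)" for x
  proof -
    have ev: "lin D scalars (\<lambda>f. f x)"
      by (simp add: lin_def full_def fscale_def)
    show ?thesis
      unfolding t(2) lin_tsum_push[OF D D is_vspace_scalars ev b t(1)] by (simp add: fscale_def)
  qed
  then have "tsum D D ?t (\<lambda>l1 l2. fscale (l1 h) l2) = dual_act h l"
    by (simp add: dual_act_def fun_eq_iff)
  then show ?thesis
    using lin_tsum_push[OF D D is_vspace_tprod lin_tens_left[OF v] b t(1)] by simp
qed

end


section \<open>The braided system\<close>

theorem theorem4:
  fixes sH :: "'k::field \<Rightarrow> 'h::ring_1 \<Rightarrow> 'h"
    and \<Delta> :: "'h \<Rightarrow> ('k, 'h, 'h) tensor"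
    and \<epsilon> :: "'h \<Rightarrow> 'k"
    and sM :: "'k \<Rightarrow> 'm::ab_group_add \<Rightarrow> 'm"
    and act :: "'h \<Rightarrow> 'm \<Rightarrow> 'm"
    and \<delta> :: "'m \<Rightarrow> ('k, 'm, 'h) tensor"
  assumes "bialgebra sH \<Delta> \<epsilon>"
    and "\<exists>B. finite_dimensional_vector_space sH B"
    and "yetter_drinfeld_module sH \<Delta> \<epsilon> sM act \<delta>"
  shows "let H = full sH; M = full sM; D = dual sH in
    \<exists>\<sigma>HH \<sigma>HM \<sigma>HD \<sigma>MM \<sigma>MD \<sigma>DD.
    (\<forall>h1 h2. \<sigma>HH (h1 \<otimes>\<^bsub>H,H\<^esub> h2) = (h1 * h2) \<otimes>\<^bsub>H,H\<^esub> 1) \<and>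
    (\<forall>m1 m2. \<sigma>MM (m1 \<otimes>\<^bsub>M,M\<^esub> m2) = m1 \<otimes>\<^bsub>M,M\<^esub> m2) \<and>
    (\<forall>l1\<in>carr D. \<forall>l2\<in>carr D. \<sigma>DD (l1 \<otimes>\<^bsub>D,D\<^esub> l2) = \<epsilon> \<otimes>\<^bsub>D,D\<^esub> dual_mult sH \<Delta> l1 l2) \<and>
    (\<forall>h m. \<sigma>HM (h \<otimes>\<^bsub>H,M\<^esub> m) = tsum H H (\<Delta> h) (\<lambda>h1 h2. act h2 m \<otimes>\<^bsub>M,H\<^esub> h1)) \<and>
    (\<forall>h. \<forall>l\<in>carr D. \<sigma>HD (h \<otimes>\<^bsub>H,D\<^esub> l) =
       tsum H H (\<Delta> h) (\<lambda>h1 h2.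
         tsum D D (dual_comult sH l) (\<lambda>l1 l2. fscale (l1 h2) l2 \<otimes>\<^bsub>D,H\<^esub> h1))) \<and>
    (\<forall>m. \<forall>l\<in>carr D. \<sigma>MD (m \<otimes>\<^bsub>M,D\<^esub> l) =
       tsum M H (\<delta> m) (\<lambda>m0 m1.
         tsum D D (dual_comult sH l) (\<lambda>l1 l2. fscale (l1 m1) l2 \<otimes>\<^bsub>D,M\<^esub> m0))) \<and>
    braided_system3 H M D \<sigma>HH \<sigma>HM \<sigma>HD \<sigma>MM \<sigma>MD \<sigma>DD"
proof -
  interpret yetter_drinfeld_module sH \<Delta> \<epsilon> sM act \<delta> by fact
  interpret yetter_drinfeld_with_module sH \<Delta> \<epsilon> sM act \<delta> "dual sH" dual_act
    by (intro yetter_drinfeld_with_module.intro yetter_drinfeld_module_axioms H_module_D)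
  interpret HA: unital_algebra H "(*)" 1 by (rule H_algebra)
  interpret DA: module_algebra sH \<Delta> \<epsilon> D dual_act "dual_mult sH \<Delta>" \<epsilon> by (rule module_algebra_D)
  interpret HDA: comodule_with_module_algebra sH \<Delta> \<epsilon> H \<Delta> D dual_act "dual_mult sH \<Delta>" \<epsilon>
    by (intro comodule_with_module_algebra.intro HX.comodule_with_module_axioms DA.module_algebra_axioms)
  interpret MDA: comodule_with_module_algebra sH \<Delta> \<epsilon> M \<delta> D dual_act "dual_mult sH \<Delta>" \<epsilon>
    by (intro comodule_with_module_algebra.intro MX.comodule_with_module_axioms DA.module_algebra_axioms)
  obtain B where fd: "finite_dimensional_vector_space sH B" using assms(2) by blast
  have "braided_system3 H M D HA.fuse_left HM.\<sigma> HX.\<sigma> id MX.\<sigma> DA.fuse_right"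
    unfolding braided_system3_def
    by (intro conjI H M D HA.lin_fuse_left HM.lin_braid HX.lin_braid lin_id MX.lin_braid DA.lin_fuse_right
        HA.yang_baxter_fuse_left H_module.yang_baxter_fuse_braid[OF H_module_M]
        H_module.yang_baxter_fuse_braid[OF H_module_D] yang_baxter_id_last[OF H M HM.lin_braid _ lin_id]
        yang_baxter_yetter_drinfeld HDA.yang_baxter_braid_fuse yang_baxter_id_last[OF M M lin_id _ lin_id]
        yang_baxter_id_first[OF M D MX.lin_braid _ lin_id] MDA.yang_baxter_braid_fuse
        DA.yang_baxter_fuse_right) simp_all
  then show ?thesis
    unfolding Let_def
    by (intro exI conjI)
      (auto simp: HA.fuse_left_tens DA.fuse_right_tens HM.braid_tens_tsum HX.braid_tens_tsum MX.braid_tens_tsum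
        dual_comult_evaluation[OF fd _ H] dual_comult_evaluation[OF fd _ M])
qed

end
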